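(* Let $n\ge 2$. For every Schur-positive set $A\subseteq\mathfrak{S}_{n-1}$, the set $AC_n=\{\sigma c:\ \sigma\in A,\ c\in C_n\}\subseteq\mathfrak{S}_n$ is cyclic Schur-positive.
   Context: Permutations are written in one-line notation and composed right to left, $(\sigma\tau)(i)=\sigma(\tau(i))$. For $\pi\in\mathfrak{S}_n$, $\mathrm{Des}(\pi)=\{i\in[n-1]:\pi(i)>\pi(i+1)\}$ and the cyclic descent set is $\mathrm{cDes}(\pi)=\{i\in[n]:\pi(i)>\pi(i+1)\}$ with the convention $\pi(n+1):=\pi(1)$. For $J\subseteq[n]$ write $\mathbf{x}^J=\prod_{i\in J}x_i$, and for an integer $i$ let $i+J=\{i+j \bmod n: j\in J\}\subseteq[n]$ (residues in $[n]$). Let $c_n=(1,2,\dots,n)=23\cdots n1$ and $C_n=\langle c_n\rangle$; $\mathfrak{S}_{n-1}$ is identified with the permutations in $\mathfrak{S}_n$ fixing $n$. Schur-positivity: for $D\subseteq[n-1]$ let $\mathcal{F}_{n,D}=\sum x_{i_1}\cdots x_{i_n}$, summed over $i_1\le\cdots\le i_n$ with $i_j<i_{j+1}$ whenever $j\in D$ (Gessel's fundamental quasisymmetric function). A set $A\subseteq\mathfrak{S}_m$ is Schur-positive if $\sum_{\pi\in A}\mathcal{F}_{m,\mathrm{Des}(\pi)}$ is symmetric and has nonnegative coefficients in the Schur basis. Cyclic Schur-positivity: for a skew shape $\lambda/\mu$ with $n$ cells (English notation), the descent set of a standard Young tableau $T$ is the set of $i\in[n-1]$ such that $i+1$ lies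 in a strictly lower row than $i$. A cyclic descent extension on $\mathrm{SYT}(\lambda/\mu)$ is a pair $(\mathrm{cDes},\psi)$, where $\mathrm{cDes}:\mathrm{SYT}(\lambda/\mu)\to 2^{[n]}$ and $\psi$ is a bijection of $\mathrm{SYT}(\lambda/\mu)$, such that for all $T$: $\mathrm{cDes}(T)\cap[n-1]=\mathrm{Des}(T)$, $\mathrm{cDes}(\psi T)=1+\mathrm{cDes}(T)$, and $\emptyset\ne\mathrm{cDes}(T)\ne[n]$. Such an extension exists if and only if $\lambda/\mu$ is not a connected ribbon, and then $\sum_{T\in\mathrm{SYT}(\lambda/\mu)}\mathbf{x}^{\mathrm{cDes}(T)}$ does not depend on the choice of extension. A set $A\subseteq\mathfrak{S}_n$ is cyclic Schur-positive (cSp) if there are nonnegative integers $m_{\lambda/\mu}$, indexed by skew shapes with $n$ cells that are not connected ribbons, such that $\sum_{\pi\in A}\mathbf{x}^{\mathrm{cDes}(\pi)}=\sum_{\lambda/\mu}m_{\lambda/\mu}\sum_{T\in\mathrm{SYT}(\lambda/\mu)}\mathbf{x}^{\mathrm{cDes}(T)}$. *)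

theory Defs
  imports Complex_Main "HOL-Combinatorics.Permutations"
begin

section \<open>Permutations, descents, cyclic descents\<close>

text \<open>Permutations of [n] are functions nat => nat permuting {1..n}; composition
  right to left is function composition.\<close>

definition des :: "nat \<Rightarrow> (nat \<Rightarrow> nat) \<Rightarrow> nat set" where
  "des n p = {i \<in> {1..n-1}. p i > p (i+1)}"

definition cdes :: "nat \<Rightarrow> (nat \<Rightarrow> nat) \<Rightarrow> nat set" where
  "cdes n p = {i \<in> {1..n}. p i > p (if i = n then 1 else i+1)}"

text \<open>The long cycle c_n = (1,2,...,n) and the cyclic group C_n it generates.\<close>

definition cyc :: "nat \<Rightarrow> nat \<Rightarrow> nat" where
  "cyc n i = (if 1 \<le> i \<and> i < n then i+1 else if i = n then 1 else i)"

definition cyclic_group :: "nat \<Rightarrow> (nat \<Rightarrow> nat) set" where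
  "cyclic_group n = {cyc n ^^ k | k. True}"

text \<open>1 + J for J a subset of [n] (residues taken in [n]).\<close>

definition shift1 :: "nat \<Rightarrow> nat set \<Rightarrow> nat set" where
  "shift1 n J = (\<lambda>j. j mod n + 1) ` J"

section \<open>Formal power series in countably many variables x_0, x_1, ...\<close>

text \<open>A formal power series is represented by its coefficient function on
  exponent vectors alpha :: nat => nat (monomial prod_k x_k^(alpha k)).\<close>

type_synonym fps_inf = "(nat \<Rightarrow> nat) \<Rightarrow> real"

text \<open>Gessel's fundamental quasisymmetric function F_{m,D}: the coefficient of
  x^alpha is the number of weakly increasing index words i_1..i_m, strict at
  positions in D, whose content is alpha.\<close>

definition fundamental :: "nat \<Rightarrow> nat set \<Rightarrow> fps_inf" where
  "fundamental m D alpha = real (card {w :: nat list. length w = m \<and> sorted w \<and>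
      (\<forall>j\<in>D. 1 \<le> j \<and> j < m \<longrightarrow> w ! (j-1) < w ! j) \<and>
      (\<forall>k. count_list w k = alpha k)})"

definition symmetric_fps :: "fps_inf \<Rightarrow> bool" where
  "symmetric_fps f \<longleftrightarrow> (\<forall>p alpha. bij p \<longrightarrow> f (alpha \<circ> p) = f alpha)"

section \<open>Partitions, skew shapes, tableaux (English notation, 0-indexed rows/columns)\<close>

definition is_partition :: "nat list \<Rightarrow> bool" where
  "is_partition lam \<longleftrightarrow> sorted_wrt (\<ge>) lam \<and> (\<forall>x\<in>set lam. 0 < x)"

definition part :: "nat list \<Rightarrow> nat \<Rightarrow> nat" where
  "part mu r = (if r < length mu then mu ! r else 0)"

definition skew_shape :: "nat list \<Rightarrow> nat list \<Rightarrow> bool" where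
  "skew_shape lam mu \<longleftrightarrow> is_partition lam \<and> is_partition mu \<and>
     length mu \<le> length lam \<and> (\<forall>i<length mu. mu ! i \<le> lam ! i)"

text \<open>Cells (row, column) of lam/mu; row index grows downwards.\<close>

definition cells :: "nat list \<Rightarrow> nat list \<Rightarrow> (nat \<times> nat) set" where
  "cells lam mu = {(r, c). r < length lam \<and> part mu r \<le> c \<and> c < lam ! r}"

text \<open>Semistandard Young tableaux of shape lam/mu with content alpha.\<close>

definition ssyt :: "nat list \<Rightarrow> nat list \<Rightarrow> (nat \<Rightarrow> nat) \<Rightarrow> ((nat \<times> nat) \<Rightarrow> nat) set" where
  "ssyt lam mu alpha = {T. (\<forall>x. x \<notin> cells lam mu \<longrightarrow> T x = 0) \<and>
     (\<forall>r c. (r, c) \<in> cells lam mu \<and> (r, c+1) \<in> cells lam mu \<longrightarrow> T (r, c) \<le> T (r, c+1)) \<and>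
     (\<forall>r c. (r, c) \<in> cells lam mu \<and> (r+1, c) \<in> cells lam mu \<longrightarrow> T (r, c) < T (r+1, c)) \<and>
     (\<forall>k. card {x \<in> cells lam mu. T x = k} = alpha k)}"

text \<open>Schur function s_lam (combinatorial definition via SSYT).\<close>

definition schur :: "nat list \<Rightarrow> fps_inf" where
  "schur lam alpha = real (card (ssyt lam [] alpha))"

definition partitions_of :: "nat \<Rightarrow> nat list set" where
  "partitions_of m = {lam. is_partition lam \<and> sum_list lam = m}"

text \<open>Schur-positivity of a set A of permutations of [m].\<close>

definition schur_positive :: "nat \<Rightarrow> (nat \<Rightarrow> nat) set \<Rightarrow> bool" where
  "schur_positive m A \<longleftrightarrow>
     (let Q = (\<lambda>alpha. \<Sum>p\<in>A. fundamental m (des m p) alpha) in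
      symmetric_fps Q \<and>
      (\<exists>c :: nat list \<Rightarrow> real. (\<forall>lam. 0 \<le> c lam) \<and>
          Q = (\<lambda>alpha. \<Sum>lam\<in>partitions_of m. c lam * schur lam alpha)))"

text \<open>Standard Young tableaux of shape lam/mu and their descent sets.\<close>

definition syt :: "nat list \<Rightarrow> nat list \<Rightarrow> ((nat \<times> nat) \<Rightarrow> nat) set" where
  "syt lam mu = {T. (\<forall>x. x \<notin> cells lam mu \<longrightarrow> T x = 0) \<and>
     bij_betw T (cells lam mu) {1..card (cells lam mu)} \<and>
     (\<forall>r c. (r, c) \<in> cells lam mu \<and> (r, c+1) \<in> cells lam mu \<longrightarrow> T (r, c) < T (r, c+1)) \<and>
     (\<forall>r c. (r, c) \<in> cells lam mu \<and> (r+1, c) \<in> cells lam mu \<longrightarrow> T (r, c) < T (r+1, c))}"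

definition syt_des :: "nat list \<Rightarrow> nat list \<Rightarrow> ((nat \<times> nat) \<Rightarrow> nat) \<Rightarrow> nat set" where
  "syt_des lam mu T = {i \<in> {1..card (cells lam mu) - 1}. \<exists>x y. x \<in> cells lam mu \<and> y \<in> cells lam mu \<and>
      T x = i \<and> T y = i + 1 \<and> fst x < fst y}"

text \<open>Connected ribbons: edge-connected skew shapes containing no 2x2 square.\<close>

definition cell_adj :: "(nat \<times> nat) set \<Rightarrow> ((nat \<times> nat) \<times> (nat \<times> nat)) set" where
  "cell_adj C = {((r, c), (r', c')). (r, c) \<in> C \<and> (r', c') \<in> C \<and>
      ((r = r' \<and> (c' = c + 1 \<or> c = c' + 1)) \<or> (c = c' \<and> (r' = r + 1 \<or> r = r' + 1)))}"

definition connected_ribbon :: "nat list \<Rightarrow> nat list \<Rightarrow> bool" where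
  "connected_ribbon lam mu \<longleftrightarrow>
     (let C = cells lam mu in
       (\<forall>x\<in>C. \<forall>y\<in>C. (x, y) \<in> (cell_adj C)\<^sup>*) \<and>
       \<not> (\<exists>r c. (r, c) \<in> C \<and> (r+1, c) \<in> C \<and> (r, c+1) \<in> C \<and> (r+1, c+1) \<in> C))"

text \<open>Cyclic descent extension (cDes, psi) on SYT(lam/mu).\<close>

definition cyclic_descent_ext :: "nat list \<Rightarrow> nat list \<Rightarrow>
    (((nat \<times> nat) \<Rightarrow> nat) \<Rightarrow> nat set) \<Rightarrow> (((nat \<times> nat) \<Rightarrow> nat) \<Rightarrow> ((nat \<times> nat) \<Rightarrow> nat)) \<Rightarrow> bool" where
  "cyclic_descent_ext lam mu cD psi \<longleftrightarrow>
     (let n = card (cells lam mu) in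
       bij_betw psi (syt lam mu) (syt lam mu) \<and>
       (\<forall>T\<in>syt lam mu.
          cD T \<subseteq> {1..n} \<and>
          cD T \<inter> {1..n-1} = syt_des lam mu T \<and>
          cD (psi T) = shift1 n (cD T) \<and>
          cD T \<noteq> {} \<and> cD T \<noteq> {1..n}))"

text \<open>Cyclic Schur-positivity. Since the polynomials x^J (J subset of [n]) are
  distinct squarefree monomials, equality of the generating polynomials is
  equality of the coefficient of every x^J. Skew shapes are indexed by pairs
  (lam, mu); for each shape used, a cyclic descent extension is chosen (the
  resulting sum is independent of this choice).\<close>

definition cyclic_schur_positive :: "nat \<Rightarrow> (nat \<Rightarrow> nat) set \<Rightarrow> bool" where
  "cyclic_schur_positive n A \<longleftrightarrow>
     (\<exists>(m :: nat list \<times> nat list \<Rightarrow> nat)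
        (cD :: nat list \<times> nat list \<Rightarrow> ((nat \<times> nat) \<Rightarrow> nat) \<Rightarrow> nat set).
        finite {s. m s \<noteq> 0} \<and>
        (\<forall>s. m s \<noteq> 0 \<longrightarrow>
             skew_shape (fst s) (snd s) \<and> card (cells (fst s) (snd s)) = n \<and>
             \<not> connected_ribbon (fst s) (snd s) \<and>
             (\<exists>psi. cyclic_descent_ext (fst s) (snd s) (cD s) psi)) \<and>
        (\<forall>J. card {p \<in> A. cdes n p = J} =
             (\<Sum>s\<in>{s. m s \<noteq> 0}. m s * card {T \<in> syt (fst s) (snd s). cD s T = J})))"

end

theory Submission
  imports Defs "HOL-Library.Product_Lexorder" "HOL-Library.Multiset"
begin

text \<open>For \<open>\<sigma> \<in> A\<close>, extended by \<open>\<sigma>(n) = n\<close>, the cyclic descent set of the \<open>k\<close>-th rotation of \<open>\<sigma>\<close> is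
  \<open>k + (Des \<sigma> \<union> {n})\<close>. Hence it suffices to treat, for each partition \<open>\<lambda>\<close> of \<open>n - 1\<close>, the multiset of
  sets \<open>k + (Des S \<union> {n})\<close> with \<open>S \<in> SYT(\<lambda>)\<close> and \<open>k \<in> [n]\<close>, and the shape realizing it is \<open>\<lambda>\<close> with a
  disconnected cell added at the upper right. A cyclic descent extension of the required kind exists
  on this shape as soon as restricting those sets to \<open>[n - 1]\<close> yields the multiset of ordinary
  descent sets, since then any descent-preserving bijection transports the rotation. Counting
  tableaux with descents in a prescribed set turns this into an equality of two Kostka numbers
  whose contents are rearrangements of one another, that is, into the symmetry of Schur functions.
  The multiplicities are integers because the Kostka matrix is unitriangular.\<close>

section \<open>Straight shapes and standardization\<close>

text \<open>Descent sets are never compared one by one, only through the numbers of objects whose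
  descent set lies in a given \<open>E\<close>. These numbers determine the distribution by
  inversion over subsets, and each of them is a coefficient at the content of a weakly increasing
  word whose rises mark the allowed descents. The decisive comparison is made for each
  \<open>lam\<close> and each \<open>k\<close> separately. If \<open>k < n\<close>, the rotated set
  and the descent set of the tableau with \<open>k\<close> in the added cell both contain
  \<open>k\<close>, so only sets \<open>E\<close> with \<open>k\<close> in \<open>E\<close>
  contribute. For such \<open>E\<close> the word has a rise at \<open>k\<close>: the letters before
  and after the cut have no value in common. Moving the part after the cut to the front therefore
  permutes whole blocks of equal letters, and the content changes only by a permutation of the
  alphabet. For \<open>k = n\<close> there is nothing to move. Because equality of counts is all
  that this yields, the bijection behind the cyclic descent extension is chosen rather than
  constructed.\<close>

lemma cells_straight: "(r, c) \<in> cells lam [] \<longleftrightarrow> c < part lam r"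
  by (auto simp: cells_def part_def)

lemma part_antimono:
  assumes "is_partition lam" "r \<le> s"
  shows "part lam s \<le> part lam r"
proof (cases "r = s")
  case False
  then show ?thesis
    using assms sorted_wrt_nth_less[of "(\<ge>)" lam r s] by (auto simp: part_def is_partition_def)
qed simp

lemma cells_straight_eq: "cells lam [] = (SIGMA r:{..<length lam}. {..<part lam r})"
  by (auto simp: cells_def part_def)

lemma finite_cells: "finite (cells lam mu)"
proof (rule finite_subset)
  show "cells lam mu \<subseteq> (SIGMA r:{..<length lam}. {..<lam ! r})"
    by (auto simp: cells_def)
qed auto

lemma card_cells_straight: "card (cells lam []) = sum_list lam"
  by (simp add: cells_straight_eq sum_list_sum_nth part_def atLeast0LessThan)

lemma cell_closed:
  assumes "is_partition lam" "(r', c') \<in> cells lam []" "r \<le> r'" "c \<le> c'"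
  shows "(r, c) \<in> cells lam []"
  using assms part_antimono[of lam r r'] by (auto simp: cells_straight)

definition semistandard :: "nat list \<Rightarrow> (nat \<times> nat \<Rightarrow> nat) \<Rightarrow> bool" where
  "semistandard lam T \<longleftrightarrow> (\<forall>x. x \<notin> cells lam [] \<longrightarrow> T x = 0) \<and>
     (\<forall>r c. (r, c) \<in> cells lam [] \<and> (r, c+1) \<in> cells lam [] \<longrightarrow> T (r, c) \<le> T (r, c+1)) \<and>
     (\<forall>r c. (r, c) \<in> cells lam [] \<and> (r+1, c) \<in> cells lam [] \<longrightarrow> T (r, c) < T (r+1, c))"

lemma ssyt_iff:
  "T \<in> ssyt lam [] alpha \<longleftrightarrow>
     semistandard lam T \<and> (\<forall>k. card {x \<in> cells lam []. T x = k} = alpha k)"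
  by (auto simp: ssyt_def semistandard_def)

lemma syt_iff:
  "T \<in> syt lam [] \<longleftrightarrow>
     semistandard lam T \<and> bij_betw T (cells lam []) {1..card (cells lam [])}"
proof
  assume "T \<in> syt lam []"
  then show "semistandard lam T \<and> bij_betw T (cells lam []) {1..card (cells lam [])}"
    by (auto simp: syt_def semistandard_def less_imp_le)
next
  assume *: "semistandard lam T \<and> bij_betw T (cells lam []) {1..card (cells lam [])}"
  have "T (r, c) \<noteq> T (r, c+1)" if "(r, c) \<in> cells lam []" "(r, c+1) \<in> cells lam []" for r c
    using * inj_onD[of T "cells lam []" "(r, c)" "(r, c+1)"] that by (auto simp: bij_betw_def)
  with * show "T \<in> syt lam []"
    unfolding syt_def semistandard_def by (simp add: le_neq_implies_less)
qed

lemma semistandard_row: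
  assumes "is_partition lam" "semistandard lam T" "(r, c') \<in> cells lam []" "c \<le> c'"
  shows "T (r, c) \<le> T (r, c')"
  using assms(4,3)
proof (induction c' rule: dec_induct)
  case (step d)
  then have "(r, d) \<in> cells lam []" by (auto simp: cells_straight)
  with step assms(2) show ?case by (fastforce simp: semistandard_def)
qed simp

lemma semistandard_col:
  assumes "is_partition lam" "semistandard lam T" "(r', c) \<in> cells lam []" "r < r'"
  shows "T (r, c) < T (r', c)"
  using assms(4,3)
proof (induction r')
  case (Suc d)
  have d: "(d, c) \<in> cells lam []"
    using Suc.prems cell_closed[OF assms(1), of "Suc d" c d c] by auto
  then have "T (d, c) < T (Suc d, c)"
    using assms(2) Suc.prems by (auto simp: semistandard_def)
  moreover have "T (r, c) \<le> T (d, c)"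
    using Suc.IH Suc.prems d by (cases "r = d") auto
  ultimately show ?case by simp
qed simp

lemma semistandard_le:
  assumes "is_partition lam" "semistandard lam T" "(r', c') \<in> cells lam []" "r \<le> r'" "c \<le> c'"
  shows "T (r, c) \<le> T (r', c')"
proof -
  have "(r', c) \<in> cells lam []" using assms cell_closed by blast
  then have "T (r, c) \<le> T (r', c)"
    using semistandard_col[OF assms(1,2), of r' c r] assms(4) by (cases "r = r'") auto
  with semistandard_row[OF assms(1,2,3,5)] show ?thesis by simp
qed

lemma semistandard_less:
  assumes "is_partition lam" "semistandard lam T" "(r', c') \<in> cells lam []" "r < r'" "c \<le> c'"
  shows "T (r, c) < T (r', c')"
proof -
  have "(r', c) \<in> cells lam []" using assms cell_closed[of lam r' c' r' c] by auto
  then show ?thesis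
    using semistandard_col[OF assms(1,2) _ assms(4)] semistandard_row[OF assms(1,2,3,5)]
    by (meson less_le_trans)
qed

section \<open>Ranks in a finite set ordered by a key\<close>

lemma bij_betw_rank:
  fixes key :: "'a \<Rightarrow> 'b::linorder"
  assumes fin: "finite C" and inj: "inj_on key C"
  shows "bij_betw (\<lambda>x. card {y \<in> C. key y \<le> key x}) C {1..card C}"
proof -
  let ?r = "\<lambda>x. card {y \<in> C. key y \<le> key x}"
  have less: "?r x < ?r y" if "x \<in> C" "y \<in> C" "key x < key y" for x y
  proof (rule psubset_card_mono)
    have "y \<in> {z \<in> C. key z \<le> key y} - {z \<in> C. key z \<le> key x}" using that by auto
    moreover have "{z \<in> C. key z \<le> key x} \<subseteq> {z \<in> C. key z \<le> key y}" using that by auto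
    ultimately show "{z \<in> C. key z \<le> key x} \<subset> {z \<in> C. key z \<le> key y}" by blast
  qed (use fin in auto)
  have "inj_on ?r C"
  proof (rule inj_onI)
    fix x y assume "x \<in> C" "y \<in> C" "?r x = ?r y"
    then have "key x = key y" using less[of x y] less[of y x] by force
    with \<open>x \<in> C\<close> \<open>y \<in> C\<close> show "x = y" using inj by (auto dest: inj_onD)
  qed
  moreover have "?r ` C \<subseteq> {1..card C}"
  proof
    fix i assume "i \<in> ?r ` C"
    then obtain x where x: "x \<in> C" "i = ?r x" by auto
    have "card {x} \<le> ?r x" using x fin by (intro card_mono) auto
    moreover have "?r x \<le> card C" using fin by (intro card_mono) auto
    ultimately show "i \<in> {1..card C}" using x by auto
  qed
  ultimately show ?thesis
    using fin by (simp add: bij_betw_def card_image card_subset_eq)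
qed

text \<open>Trichotomy upgrades the one-way hypothesis to an equivalence, so \<open>S\<close> and
  \<open>key\<close> order \<open>C\<close> alike; a bijection onto an initial segment is its own
  rank function. This recovers a tableau from its image under \<open>f\<close>.\<close>

lemma bij_betw_eq_rank:
  fixes key :: "'a \<Rightarrow> 'b::linorder"
  assumes S: "bij_betw S C {1..card C}" and x: "x \<in> C"
    and mono: "\<And>x y. x \<in> C \<Longrightarrow> y \<in> C \<Longrightarrow> S x < S y \<Longrightarrow> key x < key y"
  shows "S x = card {y \<in> C. key y \<le> key x}"
proof -
  have "{y \<in> C. key y \<le> key x} = {y \<in> C. S y \<le> S x}"
  proof -
    have "key y \<le> key x \<longleftrightarrow> S y \<le> S x" if "y \<in> C" for y
    proof (cases "S y = S x")
      case True
      then have "y = x" using S x that by (auto simp: bij_betw_def dest: inj_onD)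
      then show ?thesis by simp
    next
      case False
      then show ?thesis using mono[of x y] mono[of y x] x that by force
    qed
    then show ?thesis by auto
  qed
  moreover have "S ` {y \<in> C. S y \<le> S x} = {1..S x}"
  proof -
    have im: "S ` C = {1..card C}" using S by (simp add: bij_betw_def)
    then have "S x \<le> card C" using x by fastforce
    have "{1..S x} \<subseteq> S ` {y \<in> C. S y \<le> S x}"
    proof
      fix j assume j: "j \<in> {1..S x}"
      then have "j \<in> S ` C" using im \<open>S x \<le> card C\<close> by simp
      then show "j \<in> S ` {y \<in> C. S y \<le> S x}" using j by auto
    qed
    moreover have "S ` {y \<in> C. S y \<le> S x} \<subseteq> {1..S x}" using im by force
    ultimately show ?thesis by auto
  qed
  moreover have "inj_on S {y \<in> C. S y \<le> S x}"
    using S by (auto simp: bij_betw_def intro: inj_on_subset)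
  ultimately show ?thesis by (metis card_image card_atLeastAtMost diff_Suc_1)
qed

lemma card_less_eq_sum:
  fixes T :: "'a \<Rightarrow> nat"
  assumes "finite C"
  shows "card {x \<in> C. T x < v} = (\<Sum>k<v. card {x \<in> C. T x = k})"
proof (induction v)
  case (Suc v)
  have "{x \<in> C. T x < Suc v} = {x \<in> C. T x < v} \<union> {x \<in> C. T x = v}" by auto
  moreover have "card \<dots> = card {x \<in> C. T x < v} + card {x \<in> C. T x = v}"
    using assms by (intro card_Un_disjoint) auto
  ultimately show ?case using Suc by simp
qed simp

section \<open>Standardization of semistandard tableaux\<close>

definition content :: "nat \<Rightarrow> (nat \<Rightarrow> nat) \<Rightarrow> nat \<Rightarrow> nat" where
  "content m f k = card {i \<in> {1..m}. f i = k}"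

text \<open>Pairs are compared lexicographically: cells are numbered by increasing entry, and equal
  entries from left to right.\<close>

definition std :: "nat list \<Rightarrow> (nat \<times> nat \<Rightarrow> nat) \<Rightarrow> nat \<times> nat \<Rightarrow> nat" where
  "std lam T x = (if x \<in> cells lam [] then
     card {y \<in> cells lam []. (T y, snd y) \<le> (T x, snd x)} else 0)"

lemma syt_des_iff:
  assumes "bij_betw S (cells lam mu) {1..card (cells lam mu)}"
    "x \<in> cells lam mu" "y \<in> cells lam mu" "S y = Suc (S x)"
  shows "S x \<in> syt_des lam mu S \<longleftrightarrow> fst x < fst y"
proof -
  have "S x \<ge> 1" "S y \<le> card (cells lam mu)"
    using assms bij_betwE[OF assms(1)] by auto
  moreover have "x' = x" if "x' \<in> cells lam mu" "S x' = S x" for x'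
    using assms that by (auto simp: bij_betw_def dest: inj_onD)
  moreover have "y' = y" if "y' \<in> cells lam mu" "S y' = S y" for y'
    using assms(1,3) that by (auto simp: bij_betw_def dest: inj_onD)
  ultimately show ?thesis using assms(2-4) unfolding syt_des_def by fastforce
qed

lemma syt_des_subset: "syt_des lam mu S \<subseteq> {1..card (cells lam mu) - 1}"
  by (auto simp: syt_des_def)

context
  fixes lam :: "nat list" and m :: nat and f :: "nat \<Rightarrow> nat"
  assumes part: "is_partition lam" and m: "m = card (cells lam [])"
    and mono: "\<And>i j. 1 \<le> i \<Longrightarrow> i \<le> j \<Longrightarrow> j \<le> m \<Longrightarrow> f i \<le> f j"
begin

text \<open>For consecutive values, a descent makes \<open>f\<close> rise, while a non-descent puts
  the next cell weakly above and hence strictly to the right, where the column decides. Chaining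
  consecutive values gives the general case.\<close>

lemma syt_key_mono:
  assumes S: "S \<in> syt lam []" and des: "\<forall>i\<in>syt_des lam [] S. f i < f (i+1)"
    and x: "x \<in> cells lam []" and y: "y \<in> cells lam []" and less: "S x < S y"
  shows "(f (S x), snd x) < (f (S y), snd y)"
proof -
  have ss: "semistandard lam S" and bij: "bij_betw S (cells lam []) {1..m}"
    using S by (auto simp: syt_iff m)
  have step: "(f (S u), snd u) < (f (S v), snd v)"
    if u: "u \<in> cells lam []" and v: "v \<in> cells lam []" and uv: "S v = Suc (S u)" for u v
  proof (cases "fst u < fst v")
    case True
    then have "S u \<in> syt_des lam [] S"
      using syt_des_iff bij m u v uv by blast
    then show ?thesis using des uv by auto
  next
    case False
    have "f (S u) \<le> f (S v)"
      using uv bij_betwE[OF bij] u v by (intro mono) auto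
    moreover have "snd u < snd v"
    proof (rule ccontr)
      assume "\<not> snd u < snd v"
      then have "S (fst v, snd v) \<le> S (fst u, snd u)"
        using False u by (intro semistandard_le[OF part ss]) auto
      then show False using uv by simp
    qed
    ultimately show ?thesis by (auto simp: less_prod_def)
  qed
  show ?thesis
    using less y
  proof (induction "S y" arbitrary: y)
    case (Suc j)
    show ?case
    proof (cases "S x = j")
      case True
      then show ?thesis using step[OF x] Suc by auto
    next
      case False
      then have "j \<in> {1..m}" using Suc.hyps(2) Suc.prems bij_betwE[OF bij] x by fastforce
      then obtain z where z: "z \<in> cells lam []" "S z = j"
        using bij by (metis bij_betw_def image_iff)
      have "(f (S x), snd x) < (f (S z), snd z)"
        using Suc.hyps(1)[of z] z False Suc.prems Suc.hyps(2) by simp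
      also have "\<dots> < (f (S y), snd y)"
        using step[OF z(1) Suc.prems(2)] z Suc.hyps(2) by simp
      finally show ?thesis .
    qed
  qed simp
qed

lemma std_properties:
  assumes T: "T \<in> ssyt lam [] (content m f)"
  shows "std lam T \<in> syt lam []"
    and "\<forall>i\<in>syt_des lam [] (std lam T). f i < f (i+1)"
    and "\<And>x. x \<in> cells lam [] \<Longrightarrow> f (std lam T x) = T x"
proof -
  let ?C = "cells lam []" and ?key = "\<lambda>x. (T x, snd x)"
  have ss: "semistandard lam T" and cont: "\<And>k. card {x \<in> ?C. T x = k} = content m f k"
    using T by (auto simp: ssyt_iff)
  have fin: "finite ?C" by (rule finite_cells)
  \<comment> \<open>Equal entries form a horizontal strip: lower means strictly further left. So
    keys are distinct, and numbering equal entries from left to right creates no descent.\<close>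
  have strip: "snd v < snd u"
    if "u \<in> ?C" "v \<in> ?C" "T u = T v" "fst u < fst v" for u v
  proof (rule ccontr)
    assume "\<not> snd v < snd u"
    then have "T (fst u, snd u) < T (fst v, snd v)"
      using that by (intro semistandard_less[OF part ss]) auto
    with that show False by simp
  qed
  have inj: "inj_on ?key ?C"
  proof (rule inj_onI)
    fix u v assume uv: "u \<in> ?C" "v \<in> ?C" "?key u = ?key v"
    then have "fst u = fst v" using strip[of u v] strip[of v u] by force
    with uv show "u = v" by (simp add: prod_eq_iff)
  qed
  have std: "std lam T x = card {y \<in> ?C. ?key y \<le> ?key x}" if "x \<in> ?C" for x
    using that by (simp add: std_def)
  have bij: "bij_betw (std lam T) ?C {1..card ?C}"
    using bij_betw_rank[OF fin inj] std by (subst bij_betw_cong) auto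
  have less: "std lam T u < std lam T v" if "u \<in> ?C" "v \<in> ?C" "?key u < ?key v" for u v
    unfolding std[OF that(1)] std[OF that(2)]
  proof (rule psubset_card_mono)
    have "v \<in> {y \<in> ?C. ?key y \<le> ?key v} - {y \<in> ?C. ?key y \<le> ?key u}"
      using that by (simp add: not_le del: less_prod_simp less_eq_prod_simp)
    moreover have "{y \<in> ?C. ?key y \<le> ?key u} \<subseteq> {y \<in> ?C. ?key y \<le> ?key v}"
      using that by (auto intro: order_trans less_imp_le simp del: less_prod_simp less_eq_prod_simp)
    ultimately show "{y \<in> ?C. ?key y \<le> ?key u} \<subset> {y \<in> ?C. ?key y \<le> ?key v}" by blast
  qed (use fin in auto)
  have "semistandard lam (std lam T)"
    unfolding semistandard_def
  proof (intro conjI allI impI)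
    fix r c assume rc: "(r, c) \<in> ?C \<and> (r, c + 1) \<in> ?C"
    then have "T (r, c) \<le> T (r, c + 1)" using ss by (auto simp: semistandard_def)
    then have "?key (r, c) < ?key (r, c + 1)" by auto
    then show "std lam T (r, c) \<le> std lam T (r, c + 1)" using less rc by (meson less_imp_le)
  next
    fix r c assume rc: "(r, c) \<in> ?C \<and> (r + 1, c) \<in> ?C"
    then have "T (r, c) < T (r + 1, c)" using ss by (auto simp: semistandard_def)
    then have "?key (r, c) < ?key (r + 1, c)" by auto
    then show "std lam T (r, c) < std lam T (r + 1, c)" using less rc by blast
  qed (simp add: std_def)
  then show syt: "std lam T \<in> syt lam []" using bij by (simp add: syt_iff)
  show eq: "f (std lam T x) = T x" if x: "x \<in> ?C" for x
  proof -
    let ?i = "std lam T x"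
    have i: "1 \<le> ?i" "?i \<le> m" using bij_betwE[OF bij] x m by auto
    \<comment> \<open>Equal contents give equally many cells and positions below each
      \<open>v\<close>. As \<open>f\<close> is weakly increasing, these positions form an initial
      segment, which pins \<open>f\<close> at \<open>std lam T x\<close> down to
      \<open>T x\<close>.\<close>
    have cnt: "card {y \<in> ?C. T y < v} = card {j \<in> {1..m}. f j < v}" for v
      using card_less_eq_sum[OF fin, of T v] card_less_eq_sum[of "{1..m}" f v] cont
      by (simp add: content_def)
    have lower: "card {y \<in> ?C. T y < T x} < ?i"
      unfolding std[OF x]
    proof (rule psubset_card_mono)
      have "x \<in> {y \<in> ?C. ?key y \<le> ?key x} - {y \<in> ?C. T y < T x}" using x by simp
      then show "{y \<in> ?C. T y < T x} \<subset> {y \<in> ?C. ?key y \<le> ?key x}" by auto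
    qed (use fin in auto)
    have upper: "?i \<le> card {y \<in> ?C. T y < Suc (T x)}"
      unfolding std[OF x] using fin by (intro card_mono) auto
    have "\<not> f ?i < T x"
    proof
      assume "f ?i < T x"
      have "{1..?i} \<subseteq> {j \<in> {1..m}. f j < T x}"
      proof
        fix j assume j: "j \<in> {1..?i}"
        then have "f j \<le> f ?i" using i by (intro mono) auto
        then show "j \<in> {j \<in> {1..m}. f j < T x}" using j i \<open>f ?i < T x\<close> by auto
      qed
      then have "card {1..?i} \<le> card {j \<in> {1..m}. f j < T x}" by (intro card_mono) auto
      then show False using lower cnt by simp
    qed
    moreover have "\<not> T x < f ?i"
    proof
      assume *: "T x < f ?i"
      have "{j \<in> {1..m}. f j < Suc (T x)} \<subseteq> {1..<?i}"
      proof
        fix j assume j: "j \<in> {j \<in> {1..m}. f j < Suc (T x)}"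
        then have "\<not> ?i \<le> j" using * i mono[of ?i j] by auto
        then show "j \<in> {1..<?i}" using j by auto
      qed
      then have "card {j \<in> {1..m}. f j < Suc (T x)} \<le> card {1..<?i}" by (intro card_mono) auto
      then show False using upper cnt i by simp
    qed
    ultimately show ?thesis by simp
  qed
  show "\<forall>i\<in>syt_des lam [] (std lam T). f i < f (i+1)"
  proof
    fix i assume i: "i \<in> syt_des lam [] (std lam T)"
    then obtain u v where uv: "u \<in> ?C" "v \<in> ?C" "std lam T u = i" "std lam T v = i + 1" "fst u < fst v"
      unfolding syt_des_def by blast
    have "f i \<le> f (i+1)" using i m by (intro mono) (auto simp: syt_des_def)
    moreover have "f i \<noteq> f (i+1)"
    proof
      assume "f i = f (i+1)"
      then have "T u = T v" using eq uv by metis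
      then have "?key v < ?key u" using strip uv by simp
      then show False using less[of v u] uv by simp
    qed
    ultimately show "f i < f (i+1)" by simp
  qed
qed

text \<open>Replacing each entry \<open>i\<close> of a standard tableau by \<open>f i\<close> is
  inverted by standardization. This turns every count of tableaux with restricted descents into a
  Kostka number.\<close>

lemma card_ssyt_content:
  "card (ssyt lam [] (content m f)) = card {S \<in> syt lam []. \<forall>i\<in>syt_des lam [] S. f i < f (i+1)}"
proof -
  let ?C = "cells lam []"
  let ?A = "{S \<in> syt lam []. \<forall>i\<in>syt_des lam [] S. f i < f (i+1)}"
  let ?ph = "\<lambda>S x. if x \<in> ?C then f (S x) else 0"
  have "bij_betw ?ph ?A (ssyt lam [] (content m f))"
  proof (rule bij_betw_byWitness[where f' = "std lam"])
    show "\<forall>S\<in>?A. std lam (?ph S) = S"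
    proof
      fix S assume S: "S \<in> ?A"
      then have bij: "bij_betw S ?C {1..card ?C}" and out: "\<And>x. x \<notin> ?C \<Longrightarrow> S x = 0"
        by (auto simp: syt_iff semistandard_def)
      show "std lam (?ph S) = S"
      proof
        fix x
        show "std lam (?ph S) x = S x"
        proof (cases "x \<in> ?C")
          case True
          have "S x = card {y \<in> ?C. (f (S y), snd y) \<le> (f (S x), snd x)}"
            using S by (intro bij_betw_eq_rank[OF bij True] syt_key_mono) auto
          also have "\<dots> = std lam (?ph S) x"
            unfolding std_def using True by (auto intro!: arg_cong[where f = card])
          finally show ?thesis by simp
        qed (simp add: std_def out)
      qed
    qed
    show "\<forall>T\<in>ssyt lam [] (content m f). ?ph (std lam T) = T"
      using std_properties(3) by (fastforce simp: ssyt_iff semistandard_def)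
    show "?ph ` ?A \<subseteq> ssyt lam [] (content m f)"
    proof
      fix T assume "T \<in> ?ph ` ?A"
      then obtain S where S: "S \<in> ?A" and T: "T = ?ph S" by blast
      then have bij: "bij_betw S ?C {1..card ?C}" and ss: "semistandard lam S"
        by (auto simp: syt_iff)
      have key: "(T x, snd x) < (T y, snd y)" if "x \<in> ?C" "y \<in> ?C" "S x < S y" for x y
        using syt_key_mono[of S x y] S T that by auto
      have "semistandard lam T"
        unfolding semistandard_def
      proof (intro conjI allI impI)
        fix r c assume rc: "(r, c) \<in> ?C \<and> (r, c + 1) \<in> ?C"
        moreover have "S (r, c) < S (r, c + 1)" using rc S by (auto simp: syt_def)
        ultimately have "(T (r, c), c) < (T (r, c + 1), c + 1)"
          using key[of "(r, c)" "(r, c + 1)"] by simp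
        then show "T (r, c) \<le> T (r, c + 1)" by auto
      next
        fix r c assume rc: "(r, c) \<in> ?C \<and> (r + 1, c) \<in> ?C"
        moreover have "S (r, c) < S (r + 1, c)" using rc S by (auto simp: syt_def)
        ultimately have "(T (r, c), c) < (T (r + 1, c), c)"
          using key[of "(r, c)" "(r + 1, c)"] by simp
        then show "T (r, c) < T (r + 1, c)" by auto
      qed (simp add: T)
      moreover have "card {x \<in> ?C. T x = k} = content m f k" for k
        unfolding content_def
      proof (rule bij_betw_same_card)
        show "bij_betw S {x \<in> ?C. T x = k} {i \<in> {1..m}. f i = k}"
          using bij unfolding bij_betw_def m T
          by (auto intro: inj_on_subset simp: image_iff)
      qed
      ultimately show "T \<in> ssyt lam [] (content m f)" by (simp add: ssyt_iff)
    qed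
    show "std lam ` ssyt lam [] (content m f) \<subseteq> ?A"
      using std_properties by blast
  qed
  from bij_betw_same_card[OF this] show ?thesis by simp
qed

end

section \<open>Symmetry of Schur functions\<close>

text \<open>Gelfand-Tsetlin patterns: \<open>G v r\<close> stands for the number of entries smaller than \<open>v\<close> in row \<open>r\<close>.\<close>

definition gt_patterns :: "nat list \<Rightarrow> (nat \<Rightarrow> nat) \<Rightarrow> (nat \<Rightarrow> nat \<Rightarrow> nat) set" where
  "gt_patterns lam alpha = {G. (\<forall>r. G 0 r = 0) \<and>
     (\<forall>v r. G v r \<le> G (Suc v) r) \<and> (\<forall>v r. G (Suc v) (Suc r) \<le> G v r) \<and>
     (\<exists>V. \<forall>v\<ge>V. \<forall>r. G v r = part lam r) \<and>
     (\<forall>v. (\<Sum>r<length lam. G (Suc v) r) = (\<Sum>r<length lam. G v r) + alpha v)}"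

definition gt_of :: "nat list \<Rightarrow> (nat \<times> nat \<Rightarrow> nat) \<Rightarrow> nat \<Rightarrow> nat \<Rightarrow> nat" where
  "gt_of lam T v r = card {c. c < part lam r \<and> T (r, c) < v}"

text \<open>\<open>G (Suc v)\<close> counts the entries at most \<open>v\<close>, so the entry in
  column \<open>c\<close> is the first \<open>v\<close> whose count passes \<open>c\<close>.\<close>

definition of_gt :: "nat list \<Rightarrow> (nat \<Rightarrow> nat \<Rightarrow> nat) \<Rightarrow> nat \<times> nat \<Rightarrow> nat" where
  "of_gt lam G x = (if x \<in> cells lam [] then LEAST v. snd x < G (Suc v) (fst x) else 0)"

text \<open>Rows increase weakly, so the entries below \<open>v\<close> occupy an initial segment of
  the row and their number locates them.\<close>

lemma gt_of_iff:
  assumes "is_partition lam" "semistandard lam T"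
  shows "c < gt_of lam T v r \<longleftrightarrow> c < part lam r \<and> T (r, c) < v"
proof -
  let ?S = "{c. c < part lam r \<and> T (r, c) < v}"
  have fin: "finite ?S" by auto
  have down: "c \<in> ?S" if "d \<in> ?S" "c \<le> d" for c d
    using that semistandard_row[OF assms, of r d c] by (auto simp: cells_straight)
  show ?thesis
  proof
    assume *: "c < gt_of lam T v r"
    show "c < part lam r \<and> T (r, c) < v"
    proof (rule ccontr)
      assume "\<not> (c < part lam r \<and> T (r, c) < v)"
      then have "?S \<subseteq> {..<c}" using down[of _ c]
        by (metis (no_types, lifting) leI lessThan_iff mem_Collect_eq subsetI)
      then have "card ?S \<le> card {..<c}" by (intro card_mono) auto
      then show False using * by (simp add: gt_of_def)
    qed
  next
    assume "c < part lam r \<and> T (r, c) < v"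
    then have "{..c} \<subseteq> ?S" using down[of c] by auto
    then have "card {..c} \<le> card ?S" using fin by (intro card_mono) auto
    then show "c < gt_of lam T v r" by (simp add: gt_of_def)
  qed
qed

lemma nat_le_by_less: "(\<And>c. c < a \<Longrightarrow> c < b) \<Longrightarrow> a \<le> (b::nat)"
  by (meson leI less_irrefl)

lemma nat_eq_by_less: "(\<And>c. c < a \<longleftrightarrow> c < b) \<Longrightarrow> a = (b::nat)"
  by (meson nat_neq_iff)

lemma gt_of_sum:
  "(\<Sum>r<length lam. gt_of lam T v r) = card {x \<in> cells lam []. T x < v}"
proof -
  have "{x \<in> cells lam []. T x < v} =
      (SIGMA r:{..<length lam}. {c. c < part lam r \<and> T (r, c) < v})"
    by (auto simp: cells_straight_eq)
  then show ?thesis by (simp add: gt_of_def)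
qed

lemma gt_of_in:
  assumes lam: "is_partition lam" and T: "T \<in> ssyt lam [] alpha"
  shows "gt_of lam T \<in> gt_patterns lam alpha"
proof -
  have ss: "semistandard lam T" and cont: "\<And>k. card {x \<in> cells lam []. T x = k} = alpha k"
    using T by (auto simp: ssyt_iff)
  note iff = gt_of_iff[OF lam ss]
  have "gt_of lam T 0 r = 0" for r by (simp add: gt_of_def)
  moreover have "gt_of lam T v r \<le> gt_of lam T (Suc v) r" for v r
    by (rule nat_le_by_less) (simp add: iff)
  \<comment> \<open>This interlacing inequality is column strictness: above an entry at most
    \<open>v\<close> stands one smaller than \<open>v\<close>.\<close>
  moreover have "gt_of lam T (Suc v) (Suc r) \<le> gt_of lam T v r" for v r
  proof (rule nat_le_by_less)
    fix c assume "c < gt_of lam T (Suc v) (Suc r)"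
    then have c: "(Suc r, c) \<in> cells lam []" "T (Suc r, c) \<le> v"
      by (auto simp: iff cells_straight)
    then have "T (r, c) < T (Suc r, c)" using semistandard_col[OF lam ss] by auto
    with c show "c < gt_of lam T v r"
      using part_antimono[OF lam, of r "Suc r"] by (auto simp: iff cells_straight)
  qed
  moreover have "\<exists>V. \<forall>v\<ge>V. \<forall>r. gt_of lam T v r = part lam r"
  proof -
    obtain V where V: "\<forall>y\<in>T ` cells lam []. y < V"
      using finite_nat_set_iff_bounded[of "T ` cells lam []"] finite_cells by blast
    have "gt_of lam T v r = part lam r" if "v \<ge> V" for v r
    proof (rule nat_eq_by_less)
      fix c
      have "T (r, c) < v" if "c < part lam r"
        using V \<open>v \<ge> V\<close> that by (metis cells_straight imageI order_less_le_trans)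
      then show "c < gt_of lam T v r \<longleftrightarrow> c < part lam r" by (auto simp: iff)
    qed
    then show ?thesis by blast
  qed
  moreover have "(\<Sum>r<length lam. gt_of lam T (Suc v) r) =
      (\<Sum>r<length lam. gt_of lam T v r) + alpha v" for v
    unfolding gt_of_sum by (simp add: card_less_eq_sum[OF finite_cells] cont)
  ultimately show ?thesis by (simp add: gt_patterns_def)
qed

lemma gt_patterns_mono:
  assumes "G \<in> gt_patterns lam alpha" "v \<le> w"
  shows "G v r \<le> G w r"
  using assms(2) assms(1) lift_Suc_mono_le[of "\<lambda>v. G v r" v w] by (auto simp: gt_patterns_def)

lemma gt_patterns_le_part:
  assumes "G \<in> gt_patterns lam alpha"
  shows "G v r \<le> part lam r"
proof -
  obtain V where "\<forall>v\<ge>V. \<forall>r. G v r = part lam r" using assms by (auto simp: gt_patterns_def)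
  then have "G (max v V) r = part lam r" by simp
  then show ?thesis using gt_patterns_mono[OF assms, of v "max v V" r] by simp
qed

text \<open>Counterpart of \<open>gt_of_iff\<close>. Together the two equivalences make
  \<open>gt_of\<close> and \<open>of_gt\<close> inverse to each other, by comparing which
  \<open>c\<close> or \<open>v\<close> satisfy a strict inequality.\<close>

lemma of_gt_less_iff:
  assumes G: "G \<in> gt_patterns lam alpha" and c: "(r, c) \<in> cells lam []"
  shows "of_gt lam G (r, c) < v \<longleftrightarrow> c < G v r"
proof -
  obtain V where V: "\<forall>v\<ge>V. \<forall>r. G v r = part lam r" using G by (auto simp: gt_patterns_def)
  let ?P = "\<lambda>v. c < G (Suc v) r"
  have eq: "of_gt lam G (r, c) = (LEAST v. ?P v)" using c by (simp add: of_gt_def)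
  have "?P V" using V c by (simp add: cells_straight)
  then have P: "?P (of_gt lam G (r, c))" unfolding eq by (rule LeastI)
  show ?thesis
  proof
    assume "of_gt lam G (r, c) < v"
    then have "G (Suc (of_gt lam G (r, c))) r \<le> G v r" by (intro gt_patterns_mono[OF G]) simp
    then show "c < G v r" using P by simp
  next
    assume *: "c < G v r"
    then obtain w where w: "v = Suc w" using G by (cases v) (auto simp: gt_patterns_def)
    then have "of_gt lam G (r, c) \<le> w" unfolding eq using * by (intro Least_le) simp
    then show "of_gt lam G (r, c) < v" using w by simp
  qed
qed

lemma of_gt_semistandard:
  assumes lam: "is_partition lam" and G: "G \<in> gt_patterns lam alpha"
  shows "semistandard lam (of_gt lam G)"
  unfolding semistandard_def
proof (intro conjI allI impI)
  fix r c assume rc: "(r, c) \<in> cells lam [] \<and> (r, c + 1) \<in> cells lam []"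
  let ?v = "of_gt lam G (r, c + 1)"
  have "c + 1 < G (Suc ?v) r" using of_gt_less_iff[OF G, of r "c + 1" "Suc ?v"] rc by blast
  then have "of_gt lam G (r, c) < Suc ?v" using of_gt_less_iff[OF G, of r c "Suc ?v"] rc by simp
  then show "of_gt lam G (r, c) \<le> ?v" by simp
next
  fix r c assume rc: "(r, c) \<in> cells lam [] \<and> (r + 1, c) \<in> cells lam []"
  let ?v = "of_gt lam G (r + 1, c)"
  have "c < G (Suc ?v) (Suc r)" using of_gt_less_iff[OF G, of "r + 1" c "Suc ?v"] rc by simp
  also have "\<dots> \<le> G ?v r" using G by (simp add: gt_patterns_def)
  finally show "of_gt lam G (r, c) < ?v" using of_gt_less_iff[OF G, of r c ?v] rc by simp
qed (simp add: of_gt_def)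

lemma gt_of_of_gt:
  assumes lam: "is_partition lam" and G: "G \<in> gt_patterns lam alpha"
  shows "gt_of lam (of_gt lam G) = G"
proof (intro ext nat_eq_by_less)
  fix v r c
  show "c < gt_of lam (of_gt lam G) v r \<longleftrightarrow> c < G v r"
    using gt_of_iff[OF lam of_gt_semistandard[OF assms], of c v r] of_gt_less_iff[OF G, of r c v]
      gt_patterns_le_part[OF G, of v r] by (auto simp: cells_straight)
qed

lemma of_gt_in:
  assumes lam: "is_partition lam" and G: "G \<in> gt_patterns lam alpha"
  shows "of_gt lam G \<in> ssyt lam [] alpha"
proof -
  let ?T = "of_gt lam G"
  have "card {x \<in> cells lam []. ?T x = k} = alpha k" for k
  proof -
    have "card {x \<in> cells lam []. ?T x < Suc k} =
        card {x \<in> cells lam []. ?T x < k} + alpha k"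
      using G unfolding gt_of_sum[symmetric] gt_of_of_gt[OF assms] by (simp add: gt_patterns_def)
    then show ?thesis by (simp add: card_less_eq_sum[OF finite_cells])
  qed
  then show ?thesis using of_gt_semistandard[OF assms] by (simp add: ssyt_iff)
qed

lemma of_gt_gt_of:
  assumes lam: "is_partition lam" and T: "T \<in> ssyt lam [] alpha"
  shows "of_gt lam (gt_of lam T) = T"
proof
  fix x
  have ss: "semistandard lam T" using T by (simp add: ssyt_iff)
  show "of_gt lam (gt_of lam T) x = T x"
  proof (cases "x \<in> cells lam []")
    case True
    obtain r c where x: "x = (r, c)" by (cases x)
    have "of_gt lam (gt_of lam T) x < v \<longleftrightarrow> T x < v" for v
      using of_gt_less_iff[OF gt_of_in[OF assms], of r c v] gt_of_iff[OF lam ss, of c v r] True x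
      by (simp add: cells_straight)
    then show ?thesis by (meson nat_neq_iff)
  next
    case False
    then have "T x = 0" using ss unfolding semistandard_def by blast
    with False show ?thesis by (simp add: of_gt_def)
  qed
qed

lemma card_ssyt_eq_gt:
  assumes "is_partition lam"
  shows "card (ssyt lam [] alpha) = card (gt_patterns lam alpha)"
proof (rule bij_betw_same_card[OF bij_betw_byWitness[where f = "gt_of lam" and f' = "of_gt lam"]])
qed (use assms gt_of_in of_gt_in gt_of_of_gt of_gt_gt_of in \<open>auto\<close>)

text \<open>The Bender-Knuth involution: in a Gelfand-Tsetlin pattern the entries of row \<open>i\<close> range
  independently over intervals determined by the two neighbouring rows; each entry is reflected in
  its interval.\<close>

definition toggle :: "nat \<Rightarrow> (nat \<Rightarrow> nat \<Rightarrow> nat) \<Rightarrow> nat \<Rightarrow> nat \<Rightarrow> nat" where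
  "toggle i G v r = (if v = Suc i then
       max (G i r) (G (Suc (Suc i)) (Suc r)) +
       (case r of 0 \<Rightarrow> G (Suc (Suc i)) 0 | Suc s \<Rightarrow> min (G (Suc (Suc i)) r) (G i s)) - G (Suc i) r
     else G v r)"

lemma toggle_other: "v \<noteq> Suc i \<Longrightarrow> toggle i G v = G v"
  by (auto simp: toggle_def)

context
  fixes lam :: "nat list" and alpha :: "nat \<Rightarrow> nat" and i :: nat and G :: "nat \<Rightarrow> nat \<Rightarrow> nat"
  assumes G: "G \<in> gt_patterns lam alpha"
begin

private definition "lower r = max (G i r) (G (Suc (Suc i)) (Suc r))"
private definition "upper r = (case r of 0 \<Rightarrow> G (Suc (Suc i)) 0
   | Suc s \<Rightarrow> min (G (Suc (Suc i)) r) (G i s))"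

private lemma bounds: "lower r \<le> G (Suc i) r" "G (Suc i) r \<le> upper r"
  using G by (auto simp: lower_def upper_def gt_patterns_def split: nat.split)

private lemma toggle_eq: "toggle i G (Suc i) r = lower r + upper r - G (Suc i) r"
  by (simp add: toggle_def lower_def upper_def)

private lemma toggle_bounds: "lower r \<le> toggle i G (Suc i) r" "toggle i G (Suc i) r \<le> upper r"
  using bounds[of r] by (auto simp: toggle_eq)

lemma toggle_toggle: "toggle i (toggle i G) = G"
proof (intro ext)
  fix v r
  show "toggle i (toggle i G) v r = G v r"
  proof (cases "v = Suc i")
    case True
    have "toggle i (toggle i G) (Suc i) r = lower r + upper r - toggle i G (Suc i) r"
      by (subst toggle_def) (simp add: lower_def upper_def toggle_other split: nat.split)
    then show ?thesis using True bounds[of r] by (simp add: toggle_eq)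
  qed (simp add: toggle_other)
qed

text \<open>\<open>lower k\<close> and \<open>upper (Suc k)\<close> are the maximum and the minimum
  of the same two numbers, so they add up to the sum of these. The shift leaves
  \<open>upper 0\<close> and \<open>upper n\<close> unpaired; the latter vanishes by the
  hypothesis.\<close>

private lemma sum_bounds:
  "(\<Sum>r<n. lower r) + (\<Sum>r<n. upper r) =
     (\<Sum>r<n. G i r) + (\<Sum>r<n. G (Suc (Suc i)) r)"
  if "G (Suc (Suc i)) n = 0"
proof -
  have *: "(\<Sum>r<k. lower r) + (\<Sum>r<Suc k. upper r) =
      (\<Sum>r<k. G i r) + (\<Sum>r<Suc k. G (Suc (Suc i)) r)" for k
  proof (induction k)
    case (Suc k)
    have "lower k + upper (Suc k) = G i k + G (Suc (Suc i)) (Suc k)"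
      by (auto simp: lower_def upper_def max_def min_def)
    then show ?case using Suc by simp
  qed (simp add: upper_def)
  have "upper n = 0" using that by (auto simp: upper_def split: nat.split)
  then show ?thesis using *[of n] that by simp
qed

text \<open>Reflection replaces the sum of row \<open>Suc i\<close> of the pattern by the sums of
  its two neighbours minus itself. This swaps the two successive differences, which are
  \<open>alpha i\<close> and \<open>alpha (Suc i)\<close>.\<close>

lemma toggle_in: "toggle i G \<in> gt_patterns lam (alpha \<circ> transpose i (Suc i))"
proof -
  let ?G = "toggle i G"
  have zero: "G 0 r = 0" and up: "G v r \<le> G (Suc v) r" and diag: "G (Suc v) (Suc r) \<le> G v r"
    and sum: "(\<Sum>r<length lam. G (Suc v) r) = (\<Sum>r<length lam. G v r) + alpha v" for v r
    using G by (auto simp: gt_patterns_def)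
  have low: "G i r \<le> lower r" "G (Suc (Suc i)) (Suc r) \<le> lower r" for r by (auto simp: lower_def)
  have upp: "upper r \<le> G (Suc (Suc i)) r" "upper (Suc r) \<le> G i r" for r
    by (auto simp: upper_def split: nat.split)
  have "?G 0 r = 0" for r by (simp add: toggle_other zero)
  moreover have "?G v r \<le> ?G (Suc v) r" for v r
    using up[of v r] toggle_bounds[of r] low[of r] upp[of r]
    by (cases "v = Suc i"; cases "v = i") (auto simp: toggle_other)
  moreover have "?G (Suc v) (Suc r) \<le> ?G v r" for v r
    using diag[of v r] toggle_bounds[of r] toggle_bounds[of "Suc r"] low[of r] upp[of r]
    by (cases "v = Suc i"; cases "v = i") (auto simp: toggle_other)
  moreover have "\<exists>V. \<forall>v\<ge>V. \<forall>r. ?G v r = part lam r"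
  proof -
    obtain V where V: "\<forall>v\<ge>V. \<forall>r. G v r = part lam r" using G by (auto simp: gt_patterns_def)
    then have "\<forall>v\<ge>max V (Suc (Suc i)). \<forall>r. ?G v r = part lam r" by (auto simp: toggle_other)
    then show ?thesis by blast
  qed
  moreover have "(\<Sum>r<length lam. ?G (Suc v) r) =
      (\<Sum>r<length lam. ?G v r) + (alpha \<circ> transpose i (Suc i)) v" for v
  proof -
    let ?s = "\<lambda>v. \<Sum>r<length lam. G v r"
    have len: "G (Suc (Suc i)) (length lam) = 0"
      using gt_patterns_le_part[OF G, of "Suc (Suc i)" "length lam"] by (simp add: part_def)
    have "(\<Sum>r<length lam. ?G (Suc i) r) + ?s (Suc i) = ?s i + ?s (Suc (Suc i))"
    proof -
      have "toggle i G (Suc i) r + G (Suc i) r = lower r + upper r" for r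
        using bounds[of r] by (simp add: toggle_eq)
      then show ?thesis using sum_bounds[OF len] by (simp add: sum.distrib[symmetric])
    qed
    then have "(\<Sum>r<length lam. ?G (Suc i) r) = ?s i + alpha (Suc i)"
      using sum[of i] sum[of "Suc i"] by simp
    then show ?thesis using sum[of v] sum[of i]
      by (cases "v = Suc i"; cases "v = i") (auto simp: toggle_other)
  qed
  ultimately show ?thesis by (simp add: gt_patterns_def)
qed

end

section \<open>Invariance of Kostka numbers under permutations of the content\<close>

lemma card_ssyt_adjacent:
  assumes "is_partition lam"
  shows "card (ssyt lam [] (alpha \<circ> transpose i (Suc i))) = card (ssyt lam [] alpha)"
proof -
  have eq: "(alpha \<circ> transpose i (Suc i)) \<circ> transpose i (Suc i) = alpha"
    by (simp add: comp_assoc)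
  have "bij_betw (toggle i) (gt_patterns lam (alpha \<circ> transpose i (Suc i))) (gt_patterns lam alpha)"
    by (rule bij_betw_byWitness[where f' = "toggle i"])
      (use toggle_in toggle_toggle in \<open>auto dest: toggle_in[of _ lam "alpha \<circ> transpose i (Suc i)" i, unfolded eq]\<close>)
  then show ?thesis using assms by (simp add: card_ssyt_eq_gt bij_betw_same_card)
qed

text \<open>Conjugating by an adjacent transposition lengthens the distance between the swapped
  indices by one.\<close>

lemma card_ssyt_transpose:
  assumes "is_partition lam"
  shows "card (ssyt lam [] (alpha \<circ> transpose a (a + d))) = card (ssyt lam [] alpha)"
proof (induction d arbitrary: alpha)
  case (Suc d)
  show ?case
  proof (cases "d = 0")
    case True
    then show ?thesis using card_ssyt_adjacent[OF assms, of alpha a] by (simp add: comp_def)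
  next
    case False
    let ?t = "transpose (a + d) (Suc (a + d))"
    have "?t \<circ> transpose a (a + d) \<circ> ?t = transpose a (a + Suc d)"
      using False by (auto simp: fun_eq_iff transpose_def)
    then have "alpha \<circ> transpose a (a + Suc d) = ((alpha \<circ> ?t) \<circ> transpose a (a + d)) \<circ> ?t"
      by (metis comp_assoc)
    then show ?thesis
      using Suc.IH[of "alpha \<circ> ?t"] card_ssyt_adjacent[OF assms] by metis
  qed
qed simp

lemma card_ssyt_permutes:
  assumes lam: "is_partition lam" and p: "p permutes X" "finite X"
  shows "card (ssyt lam [] (alpha \<circ> p)) = card (ssyt lam [] alpha)"
  using p
proof (induction p arbitrary: alpha rule: permutes_induct)
  case (swap a b p)
  have "transpose a b = transpose (min a b) (min a b + (max a b - min a b))"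
    by (auto simp: min_def max_def transpose_commute)
  then have "card (ssyt lam [] ((alpha \<circ> transpose a b))) = card (ssyt lam [] alpha)"
    using card_ssyt_transpose[OF lam] by metis
  then show ?case using swap.IH[of "alpha \<circ> transpose a b"] by (metis comp_assoc)
qed simp

section \<open>Integrality of Schur coefficients\<close>

lemma finite_partitions_of: "finite (partitions_of m)"
proof (rule finite_subset)
  show "partitions_of m \<subseteq> {xs. set xs \<subseteq> {..m} \<and> length xs \<le> m}"
  proof
    fix lam assume lam: "lam \<in> partitions_of m"
    have "length xs \<le> sum_list xs" if "\<forall>x\<in>set xs. 0 < x" for xs :: "nat list"
      using that by (induction xs) auto
    then have "length lam \<le> m" using lam by (auto simp: partitions_of_def is_partition_def)
    moreover have "set lam \<subseteq> {..m}"
      using lam member_le_sum_list by (fastforce simp: partitions_of_def)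
    ultimately show "lam \<in> {xs. set xs \<subseteq> {..m} \<and> length xs \<le> m}" by simp
  qed
qed (simp add: finite_lists_length_le)

lemma finite_syt: "finite (syt lam mu)"
proof (rule finite_subset)
  show "syt lam mu \<subseteq> {T. \<forall>x. (x \<in> cells lam mu \<longrightarrow> T x \<in> {1..card (cells lam mu)}) \<and>
      (x \<notin> cells lam mu \<longrightarrow> T x = 0)}"
    by (auto simp: syt_def dest: bij_betwE)
qed (intro finite_set_of_finite_funs finite_cells finite_atLeastAtMost)

section \<open>Kostka numbers at partition contents\<close>

lemma part_inject:
  assumes "is_partition lam" "is_partition mu" "part lam = part mu"
  shows "lam = mu"
proof -
  have len: "r < length xs \<longleftrightarrow> 0 < part xs r" if "is_partition xs" for xs r
    using that by (auto simp: part_def is_partition_def)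
  have "length lam = length mu"
    by (rule nat_eq_by_less) (simp add: len assms)
  moreover have "lam ! r = mu ! r" if "r < length lam" for r
    using that assms(3) \<open>length lam = length mu\<close> by (metis part_def)
  ultimately show ?thesis by (simp add: nth_equalityI)
qed

lemma card_row: "card {x \<in> cells lam []. fst x = k} = part lam k"
proof -
  have "{x \<in> cells lam []. fst x = k} = {k} \<times> {..<part lam k}"
    by (auto simp: cells_straight)
  then show ?thesis by (simp add: card_cartesian_product)
qed

lemma sum_eq_of_card_fibres:
  fixes f :: "'a \<Rightarrow> nat" and g :: "'b \<Rightarrow> nat"
  assumes "finite C" "finite D" "\<And>k. card {x \<in> C. f x = k} = card {y \<in> D. g y = k}"
  shows "sum f C = sum g D"
proof -
  have "k \<in> f ` C \<longleftrightarrow> k \<in> g ` D" for k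
  proof -
    have "k \<in> f ` C \<longleftrightarrow> card {x \<in> C. f x = k} \<noteq> 0" using assms(1) by auto
    also have "\<dots> \<longleftrightarrow> card {y \<in> D. g y = k} \<noteq> 0" using assms(3) by simp
    also have "\<dots> \<longleftrightarrow> k \<in> g ` D" using assms(2) by auto
    finally show ?thesis .
  qed
  then have "f ` C = g ` D" by blast
  moreover have "sum f C = (\<Sum>k\<in>f ` C. k * card {x \<in> C. f x = k})"
    by (subst sum.image_gen[OF assms(1), of _ f]) (auto intro!: sum.cong)
  moreover have "sum g D = (\<Sum>k\<in>g ` D. k * card {x \<in> D. g x = k})"
    by (subst sum.image_gen[OF assms(2), of _ g]) (auto intro!: sum.cong)
  ultimately show ?thesis using assms(3) by simp
qed

text \<open>The statistic usually written n(lam), the sum of \<open>r * part lam r\<close>. It is a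
  numerical substitute for the dominance order.\<close>

definition row_stat :: "nat list \<Rightarrow> nat" where
  "row_stat lam = (\<Sum>x\<in>cells lam []. fst x)"

lemma semistandard_ge_row:
  assumes "is_partition lam" "semistandard lam T" "(r, c) \<in> cells lam []"
  shows "r \<le> T (r, c)"
  using assms(3)
proof (induction r)
  case (Suc r)
  have "(r, c) \<in> cells lam []" using cell_closed[OF assms(1) Suc.prems, of r c] by simp
  then have "r \<le> T (r, c)" "T (r, c) < T (Suc r, c)"
    using Suc assms(2) by (auto simp: semistandard_def)
  then show ?case by simp
qed simp

text \<open>Each entry is at least its row index, so the entries sum to at least
  \<open>row_stat lam\<close>; their content makes this sum \<open>row_stat mu\<close>. Under
  \<open>ge\<close> both bounds meet, and every entry must equal its row index.\<close>

lemma ssyt_row_stat: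
  assumes lam: "is_partition lam" and mu: "is_partition mu"
    and T: "T \<in> ssyt lam [] (part mu)" and ge: "row_stat mu \<le> row_stat lam"
  shows "lam = mu" and "\<And>x. x \<in> cells lam [] \<Longrightarrow> T x = fst x"
proof -
  have ss: "semistandard lam T" and cont: "\<And>k. card {x \<in> cells lam []. T x = k} = part mu k"
    using T by (auto simp: ssyt_iff)
  have le: "fst x \<le> T x" if "x \<in> cells lam []" for x
    using semistandard_ge_row[OF lam ss, of "fst x" "snd x"] that by simp
  have "sum T (cells lam []) = row_stat mu"
    unfolding row_stat_def by (rule sum_eq_of_card_fibres) (auto simp: finite_cells cont card_row)
  then have sum: "sum T (cells lam []) \<le> sum fst (cells lam [])" using ge by (simp add: row_stat_def)
  show eq: "T x = fst x" if "x \<in> cells lam []" for x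
  proof (rule ccontr)
    assume "T x \<noteq> fst x"
    then have "fst x < T x" using le[OF that] by simp
    then have "sum fst (cells lam []) < sum T (cells lam [])"
      using le that by (intro sum_strict_mono_ex1) (auto simp: finite_cells)
    with sum show False by simp
  qed
  have "part lam k = part mu k" for k
  proof -
    have "{x \<in> cells lam []. T x = k} = {x \<in> cells lam []. fst x = k}" using eq by auto
    then show ?thesis using cont[of k] card_row[of lam k] by simp
  qed
  then show "lam = mu" using part_inject[OF lam mu] by blast
qed

lemma schur_part_self:
  assumes "is_partition mu"
  shows "schur mu (part mu) = 1"
proof -
  let ?T = "\<lambda>x. if x \<in> cells mu [] then fst x else 0"
  have "{x \<in> cells mu []. ?T x = k} = {x \<in> cells mu []. fst x = k}" for k by auto
  then have "?T \<in> ssyt mu [] (part mu)"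
    by (simp add: ssyt_iff semistandard_def card_row)
  moreover have "T = ?T" if "T \<in> ssyt mu [] (part mu)" for T
    using ssyt_row_stat(2)[OF assms assms that] that
    by (auto simp: fun_eq_iff ssyt_iff semistandard_def)
  ultimately have "ssyt mu [] (part mu) = {?T}" by blast
  then show ?thesis by (simp add: schur_def)
qed

text \<open>Unitriangularity of the Kostka matrix, the partitions being ordered by \<open>row_stat\<close>.\<close>

lemma schur_coefficients_Ints:
  fixes c :: "nat list \<Rightarrow> real"
  assumes int: "\<And>mu. mu \<in> partitions_of m \<Longrightarrow>
      (\<Sum>lam\<in>partitions_of m. c lam * schur lam (part mu)) \<in> \<int>"
    and mu: "mu \<in> partitions_of m"
  shows "c mu \<in> \<int>"
  using mu
proof (induction "row_stat mu" arbitrary: mu rule: less_induct)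
  case less
  have pmu: "is_partition mu" using less.prems by (simp add: partitions_of_def)
  have "(\<Sum>lam\<in>partitions_of m. c lam * schur lam (part mu)) =
      c mu + (\<Sum>lam\<in>partitions_of m - {mu}. c lam * schur lam (part mu))"
    using sum.remove[OF finite_partitions_of less.prems, of "\<lambda>lam. c lam * schur lam (part mu)"]
      schur_part_self[OF pmu] by simp
  moreover have "(\<Sum>lam\<in>partitions_of m - {mu}. c lam * schur lam (part mu)) \<in> \<int>"
  proof (rule Ints_sum)
    fix lam assume lam: "lam \<in> partitions_of m - {mu}"
    then have plam: "is_partition lam" by (simp add: partitions_of_def)
    show "c lam * schur lam (part mu) \<in> \<int>"
    proof (cases "ssyt lam [] (part mu) = {}")
      case False
      then obtain T where "T \<in> ssyt lam [] (part mu)" by blast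
      then have "row_stat lam < row_stat mu"
        using ssyt_row_stat(1)[OF plam pmu, of T] lam by (auto simp: not_le[symmetric])
      then have "c lam \<in> \<int>" using less.hyps lam by blast
      then show ?thesis by (simp add: schur_def Ints_mult)
    qed (simp add: schur_def)
  qed
  ultimately show ?case using int[OF less.prems] by (metis Ints_diff add_diff_cancel_right')
qed

section \<open>Descent set statistics\<close>

text \<open>A sorted word is determined by its content, so \<open>f\<close> itself is the only
  candidate and the coefficient merely tests its rises.\<close>

lemma fundamental_content:
  assumes mono: "\<And>i j. 1 \<le> i \<Longrightarrow> i \<le> j \<Longrightarrow> j \<le> m \<Longrightarrow> f i \<le> f j"
  shows "fundamental m D (content m f) =
    (if \<forall>j\<in>D. 1 \<le> j \<and> j < m \<longrightarrow> f j < f (j+1) then 1 else 0)"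
proof -
  define w0 where "w0 = map f [1..<Suc m]"
  have len: "length w0 = m" by (simp add: w0_def)
  have nth: "w0 ! i = f (Suc i)" if "i < m" for i
    using that by (simp add: w0_def del: upt_Suc)
  have sorted: "sorted w0"
    by (auto simp: sorted_iff_nth_mono len nth intro: mono)
  have cnt: "count_list w0 k = content m f k" for k
  proof -
    have "count_list w0 k = length (filter (\<lambda>i. f i = k) [1..<Suc m])"
      unfolding w0_def count_list_eq_length_filter filter_map comp_def length_map
      by (rule arg_cong[where f = length], rule filter_cong) auto
    also have "\<dots> = card (set (filter (\<lambda>i. f i = k) [1..<Suc m]))"
      by (rule distinct_card[symmetric]) simp
    also have "set (filter (\<lambda>i. f i = k) [1..<Suc m]) = {i \<in> {1..m}. f i = k}" by auto
    finally show ?thesis by (simp add: content_def)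
  qed
  have unique: "w = w0" if "sorted w" "\<forall>k. count_list w k = content m f k" for w
  proof -
    have "mset w = mset w0" using that cnt by (intro multiset_eqI) (simp add: count_mset)
    then show ?thesis using that(1) sorted by (metis properties_for_sort sorted_sort_id)
  qed
  have strict: "(\<forall>j\<in>D. 1 \<le> j \<and> j < m \<longrightarrow> w0 ! (j-1) < w0 ! j) \<longleftrightarrow>
      (\<forall>j\<in>D. 1 \<le> j \<and> j < m \<longrightarrow> f j < f (j+1))" (is "?L \<longleftrightarrow> ?R")
    using nth by (auto simp: less_imp_diff_less)
  let ?W = "{w. length w = m \<and> sorted w \<and> (\<forall>j\<in>D. 1 \<le> j \<and> j < m \<longrightarrow> w ! (j-1) < w ! j) \<and>
      (\<forall>k. count_list w k = content m f k)}"
  have "?W \<subseteq> {w0}" using unique by blast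
  moreover have "w0 \<in> ?W \<longleftrightarrow> ?R"
    unfolding strict[symmetric] using len sorted cnt by simp
  ultimately have "?W = (if ?R then {w0} else {})" by (auto split: if_splits)
  then show ?thesis unfolding fundamental_def by (simp only: if_distrib[of card] if_distrib[of real]) simp
qed

text \<open>Uniqueness in Moebius inversion on the Boolean lattice: the top term of each sum is
  isolated by induction on \<open>E\<close>.\<close>

lemma subset_sum_inject:
  fixes a b :: "'a set \<Rightarrow> real"
  assumes "finite U" "\<And>E. E \<subseteq> U \<Longrightarrow> (\<Sum>D\<in>Pow E. a D) = (\<Sum>D\<in>Pow E. b D)" "E \<subseteq> U"
  shows "a E = b E"
proof -
  have "finite E" using assms finite_subset by blast
  then show ?thesis using assms(3)
  proof (induction E rule: finite_psubset_induct)
    case (psubset E)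
    have fin: "finite (Pow E)" using psubset.hyps by simp
    have "(\<Sum>D\<in>Pow E - {E}. a D) = (\<Sum>D\<in>Pow E - {E}. b D)"
      using psubset by (intro sum.cong) auto
    moreover have "(\<Sum>D\<in>Pow E. a D) = (\<Sum>D\<in>Pow E. b D)" using assms(2) psubset.prems by blast
    ultimately show ?case using fin by (simp add: sum.remove[of "Pow E" E])
  qed
qed

lemma sum_card_fibres:
  assumes "finite X" "finite P"
  shows "(\<Sum>D\<in>P. card {x \<in> X. g x = D}) = card {x \<in> X. g x \<in> P}"
proof -
  have "{x \<in> X. g x \<in> P} = (\<Union>D\<in>P. {x \<in> X. g x = D})" by auto
  moreover have "card \<dots> = (\<Sum>D\<in>P. card {x \<in> X. g x = D})"
    using assms by (intro card_UN_disjoint) auto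
  ultimately show ?thesis by simp
qed

text \<open>If the positions are cut after every element of \<open>E\<close>, this is the index,
  from 0, of the block of \<open>i\<close>. The word rises exactly at \<open>E\<close>, so requiring
  rises at \<open>D\<close> tests whether \<open>D\<close> is contained in \<open>E\<close>.\<close>

definition block :: "nat set \<Rightarrow> nat \<Rightarrow> nat" where
  "block E i = card {e \<in> E. e < i}"

lemma block_mono: "finite E \<Longrightarrow> i \<le> j \<Longrightarrow> block E i \<le> block E j"
  unfolding block_def by (intro card_mono) auto

lemma block_Suc:
  assumes "finite E"
  shows "block E (Suc i) = (if i \<in> E then Suc (block E i) else block E i)"
proof (cases "i \<in> E")
  case True
  then have "{e \<in> E. e < Suc i} = insert i {e \<in> E. e < i}" by auto
  then show ?thesis using assms True by (simp add: block_def)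
next
  case False
  then have "{e \<in> E. e < Suc i} = {e \<in> E. e < i}" by (auto simp: less_Suc_eq)
  then show ?thesis using False by (simp add: block_def)
qed

text \<open>At the content of \<open>block E\<close>, a fundamental function becomes the indicator
  of containment in \<open>E\<close>, and a Schur function counts the standard tableaux with
  descents in \<open>E\<close>. Inversion over subsets then isolates a single descent set.\<close>

lemma des_count:
  fixes c :: "nat list \<Rightarrow> real"
  assumes fin: "finite A"
    and Q: "\<And>alpha. (\<Sum>p\<in>A. fundamental m (des m p) alpha) =
      (\<Sum>lam\<in>partitions_of m. c lam * schur lam alpha)"
  shows "real (card {p \<in> A. des m p = D}) =
    (\<Sum>lam\<in>partitions_of m. c lam * real (card {S \<in> syt lam []. syt_des lam [] S = D}))"
proof (cases "D \<subseteq> {1..m-1}")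
  case False
  then have "{p \<in> A. des m p = D} = {}" by (auto simp: des_def)
  moreover have "{S \<in> syt lam []. syt_des lam [] S = D} = {}" if "lam \<in> partitions_of m" for lam
    using False that syt_des_subset[of lam "[]"]
    by (auto simp: partitions_of_def card_cells_straight)
  then have "(\<Sum>lam\<in>partitions_of m.
      c lam * real (card {S \<in> syt lam []. syt_des lam [] S = D})) = 0"
    by (intro sum.neutral ballI) (simp only: card.empty mult_zero_right of_nat_0)
  ultimately show ?thesis by (simp only: card.empty of_nat_0)
next
  case True
  let ?a = "\<lambda>D. real (card {p \<in> A. des m p = D})"
  let ?b = "\<lambda>D. \<Sum>lam\<in>partitions_of m. c lam * real (card {S \<in> syt lam []. syt_des lam [] S = D})"
  show ?thesis
  proof (rule subset_sum_inject[where U = "{1..m-1}" and a = ?a and b = ?b])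
    fix E :: "nat set" assume E: "E \<subseteq> {1..m-1}"
    then have finE: "finite E" by (rule finite_subset) simp
    have strict: "block E i < block E (Suc i) \<longleftrightarrow> i \<in> E" for i by (simp add: block_Suc[OF finE])
    have "sum ?a (Pow E) = real (card {p \<in> A. des m p \<subseteq> E})"
      using sum_card_fibres[OF fin, of "Pow E" "des m"] finE by (simp flip: of_nat_sum)
    also have "\<dots> = (\<Sum>p\<in>A. fundamental m (des m p) (content m (block E)))"
    proof -
      have "fundamental m (des m p) (content m (block E)) = of_bool (des m p \<subseteq> E)" for p
        by (subst fundamental_content) (auto intro: block_mono[OF finE] simp: strict des_def)
      then show ?thesis using fin by (simp add: Collect_conj_eq flip: of_bool_def)
    qed
    also have "\<dots> = (\<Sum>lam\<in>partitions_of m. c lam * real (card {S \<in> syt lam []. syt_des lam [] S \<subseteq> E}))"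
      unfolding Q
    proof (rule sum.cong)
      fix lam assume "lam \<in> partitions_of m"
      then have lam: "is_partition lam" "m = card (cells lam [])"
        by (auto simp: partitions_of_def card_cells_straight)
      have "schur lam (content m (block E)) =
          real (card {S \<in> syt lam []. \<forall>i\<in>syt_des lam [] S. block E i < block E (i+1)})"
        unfolding schur_def using card_ssyt_content[OF lam] block_mono[OF finE] by simp
      then show "c lam * schur lam (content m (block E)) =
          c lam * real (card {S \<in> syt lam []. syt_des lam [] S \<subseteq> E})"
        by (simp add: strict subset_iff Ball_def)
    qed simp
    also have "\<dots> = (\<Sum>lam\<in>partitions_of m. \<Sum>D\<in>Pow E.
        c lam * real (card {S \<in> syt lam []. syt_des lam [] S = D}))"
      using sum_card_fibres[OF finite_syt, of "Pow E"] finE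
      by (simp flip: of_nat_sum sum_distrib_left)
    also have "\<dots> = sum ?b (Pow E)" by (rule sum.swap)
    finally show "sum ?a (Pow E) = sum ?b (Pow E)" .
  qed (use True in auto)
qed

section \<open>Cyclic rotations of permutations\<close>

text \<open>The set \<open>k + (D \<union> {n})\<close>, with residues in \<open>{1..n}\<close>.\<close>

definition rotated :: "nat \<Rightarrow> nat \<Rightarrow> nat set \<Rightarrow> nat set" where
  "rotated n k D = {i \<in> {1..n}. i = k \<or> (k < i \<and> i - k \<in> D) \<or> (i < k \<and> n - k + i \<in> D)}"

lemma cyc_funpow:
  assumes "1 \<le> i" "i \<le> n" "j \<le> n"
  shows "(cyc n ^^ j) i = (if i + j \<le> n then i + j else i + j - n)"
  using assms(3)
proof (induction j)
  case (Suc j)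
  then show ?case using assms(1,2) by (auto simp: cyc_def)
qed (use assms in simp)

lemma cyc_funpow_outside: "i \<notin> {1..n} \<Longrightarrow> n \<ge> 1 \<Longrightarrow> (cyc n ^^ j) i = i"
  by (induction j) (auto simp: cyc_def)

lemma cyc_funpow_self: "n \<ge> 1 \<Longrightarrow> cyc n ^^ n = id"
proof
  fix i assume "n \<ge> 1"
  then show "(cyc n ^^ n) i = id i"
    using cyc_funpow[of i n n] cyc_funpow_outside[of i n n] by (cases "i \<in> {1..n}") auto
qed

text \<open>The exponent \<open>n - k\<close> is chosen because this power sends \<open>k\<close> to
  \<open>n\<close>: for \<open>s\<close> fixing \<open>n\<close>, the index \<open>k\<close> is the
  position of the largest value in the rotated word.\<close>

lemma cyclic_group_eq:
  assumes "n \<ge> 1"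
  shows "cyclic_group n = (\<lambda>k. cyc n ^^ (n - k)) ` {1..n}"
proof -
  have "cyc n ^^ j \<in> (\<lambda>k. cyc n ^^ (n - k)) ` {1..n}" for j
  proof
    have "j mod n < n" using assms by simp
    then have "n - (n - j mod n) = j mod n" by simp
    then show "cyc n ^^ j = cyc n ^^ (n - (n - j mod n))"
      using funpow_mod_eq[where f = "cyc n" and n = n and m = j] cyc_funpow_self[OF assms]
      by (auto simp: fun_eq_iff)
    show "n - j mod n \<in> {1..n}" using \<open>j mod n < n\<close> by auto
  qed
  then show ?thesis by (auto simp: cyclic_group_def)
qed

context
  fixes n :: nat
  assumes n: "n \<ge> 2"
begin

text \<open>Around the cyclic word, the step leaving the maximum \<open>n\<close> is a descent and
  the step into it an ascent. All other steps are those of \<open>s\<close>, shifted by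
  \<open>k\<close>.\<close>

lemma cdes_cyc:
  assumes s: "s permutes {1..n-1}" and k: "k \<in> {1..n}"
  shows "cdes n (s \<circ> cyc n ^^ (n - k)) = rotated n k (des (n - 1) s)"
proof -
  let ?p = "s \<circ> cyc n ^^ (n - k)"
  have sn: "s n = n" using permutes_not_in[OF s, of n] n by auto
  have lt: "s i < n" if "1 \<le> i" "i \<le> n - 1" for i
    using permutes_in_image[OF s, of i] that n by auto
  have p: "?p i = (if i \<le> k then s (i + n - k) else s (i - k))" if "1 \<le> i" "i \<le> n" for i
    using cyc_funpow[OF that, of "n - k"] that k by auto
  have nxt: "?p (if i = n then 1 else i + 1) =
      (if i < k then s (n - k + i + 1) else s (i - k + 1))" if "1 \<le> i" "i \<le> n" for i
  proof (cases "i = n")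
    case True
    then show ?thesis using p[of 1] k n by (auto simp: Suc_diff_le)
  next
    case False
    then show ?thesis using p[of "i + 1"] that k by (auto simp: algebra_simps Suc_diff_le)
  qed
  have "i \<in> cdes n ?p \<longleftrightarrow> i \<in> rotated n k (des (n - 1) s)" if "i \<in> {1..n}" for i
  proof -
    have i: "1 \<le> i" "i \<le> n" using that by auto
    have c: "i \<in> cdes n ?p \<longleftrightarrow>
        (if i < k then s (n - k + i + 1) else s (i - k + 1)) < (if i \<le> k then s (i + n - k) else s (i - k))"
      using i p[OF i] nxt[OF i] unfolding cdes_def by auto
    consider "i = k" | "k < i" | "i < k" "n - k + i = n - 1" | "i < k" "n - k + i < n - 1"
      using k i by fastforce
    then show ?thesis
    proof cases
      case 1
      then show ?thesis using c sn lt[of 1] i n by (auto simp: rotated_def)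
    next
      case 2
      \<comment> \<open>If \<open>k = 1\<close> and \<open>i = n\<close>, the step wraps around into
        the maximum. The difference \<open>i - k\<close> is then \<open>n - 1\<close>, which lies
        outside the range of \<open>des (n - 1)\<close>.\<close>
      have "s n > s (n - 1)" using sn lt[of "n - 1"] n by auto
      then have "i - k \<in> des (n - 1) s \<longleftrightarrow> s (i - k) > s (i - k + 1)"
        using 2 i k by (cases "i - k = n - 1") (auto simp: des_def)
      then show ?thesis using 2 c i by (auto simp: rotated_def)
    next
      case 3
      then have "n - k + i + 1 = n" "i + n - k = n - 1" using n k by auto
      then show ?thesis using 3 c i sn lt[of "n - 1"] n by (auto simp: rotated_def des_def)
    next
      case 4
      then have "i + n - k = n - k + i" "n - k + i \<le> n - 1 - 1" using k by auto
      then show ?thesis using 4 c i k by (auto simp: rotated_def des_def)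
    qed
  qed
  moreover have "cdes n ?p \<subseteq> {1..n}" "rotated n k (des (n - 1) s) \<subseteq> {1..n}"
    by (auto simp: cdes_def rotated_def)
  ultimately show ?thesis by blast
qed

text \<open>The position of the value \<open>n\<close> reveals \<open>k\<close>, and undoing the
  rotation returns \<open>s\<close>.\<close>

lemma inj_on_cyc:
  assumes A: "A \<subseteq> {s. s permutes {1..n-1}}"
  shows "inj_on (\<lambda>(s, k). s \<circ> cyc n ^^ (n - k)) (A \<times> {1..n})"
proof (rule inj_onI, clarify)
  fix s k t l
  assume st: "s \<in> A" "t \<in> A" and kl: "k \<in> {1..n}" "l \<in> {1..n}"
    and eq: "s \<circ> cyc n ^^ (n - k) = t \<circ> cyc n ^^ (n - l)"
  have perm: "s permutes {1..n-1}" "t permutes {1..n-1}" using A st by auto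
  have "s n = n" "t n = n"
    using perm n permutes_not_in[of s "{1..n-1}" n] permutes_not_in[of t "{1..n-1}" n] by auto
  have "(cyc n ^^ (n - k)) k = n" using cyc_funpow[of k n "n - k"] kl by simp
  then have "t ((cyc n ^^ (n - l)) k) = n" using fun_cong[OF eq, of k] \<open>s n = n\<close> by simp
  then have "(cyc n ^^ (n - l)) k = n" using \<open>t n = n\<close> permutes_inj[OF perm(2)] by (metis injD)
  then have "k = l" using cyc_funpow[of k n "n - l"] kl by (auto split: if_splits)
  have "s = s \<circ> cyc n ^^ (n - k) \<circ> cyc n ^^ k"
    using kl cyc_funpow_self[of n] n by (simp add: comp_assoc flip: funpow_add)
  also have "\<dots> = t \<circ> cyc n ^^ (n - k) \<circ> cyc n ^^ k" using eq \<open>k = l\<close> by simp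
  also have "\<dots> = t"
    using kl cyc_funpow_self[of n] n by (simp add: comp_assoc flip: funpow_add)
  finally show "s = t \<and> k = l" using \<open>k = l\<close> by simp
qed

lemma card_cdes_cyc:
  assumes A: "A \<subseteq> {s. s permutes {1..n-1}}"
  shows "card {p \<in> {s \<circ> c | s c. s \<in> A \<and> c \<in> cyclic_group n}. cdes n p = J} =
    card {(s, k) \<in> A \<times> {1..n}. rotated n k (des (n - 1) s) = J}"
proof -
  let ?f = "\<lambda>(s, k). s \<circ> cyc n ^^ (n - k)"
  let ?X = "{(s, k) \<in> A \<times> {1..n}. rotated n k (des (n - 1) s) = J}"
  have "{s \<circ> c | s c. s \<in> A \<and> c \<in> cyclic_group n} = ?f ` (A \<times> {1..n})"
    using n by (auto simp: cyclic_group_eq image_iff Bex_def) blast+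
  moreover have "?X = {x \<in> A \<times> {1..n}. cdes n (?f x) = J}"
    using cdes_cyc A by (auto simp: subset_iff)
  ultimately have "{p \<in> {s \<circ> c | s c. s \<in> A \<and> c \<in> cyclic_group n}. cdes n p = J} = ?f ` ?X"
    by (simp only:) blast
  moreover have "inj_on ?f ?X" by (rule inj_on_subset[OF inj_on_cyc[OF A]]) auto
  ultimately show ?thesis by (simp add: card_image)
qed

lemma rotated_shift:
  assumes D: "D \<subseteq> {1..n-1}" and k: "k \<in> {1..n}"
  shows "rotated n (k mod n + 1) D = shift1 n (rotated n k D)"
proof -
  have mem: "i \<in> shift1 n J \<longleftrightarrow> i \<in> {1..n} \<and> (if i = 1 then n else i - 1) \<in> J"
    if J: "J \<subseteq> {1..n}" for i J
  proof
    assume "i \<in> shift1 n J"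
    then obtain j where j: "j \<in> J" "i = j mod n + 1" by (auto simp: shift1_def)
    then have "1 \<le> j" "j \<le> n" using J by auto
    then show "i \<in> {1..n} \<and> (if i = 1 then n else i - 1) \<in> J"
      using j n by (cases "j = n") auto
  next
    assume *: "i \<in> {1..n} \<and> (if i = 1 then n else i - 1) \<in> J"
    then show "i \<in> shift1 n J"
      unfolding shift1_def by (intro image_eqI[where x = "if i = 1 then n else i - 1"]) auto
  qed
  have sub: "rotated n k D \<subseteq> {1..n}" by (auto simp: rotated_def)
  have nD: "n \<notin> D" "0 \<notin> D" using D n by auto
  have "i \<in> rotated n (k mod n + 1) D \<longleftrightarrow> (if i = 1 then n else i - 1) \<in> rotated n k D"
    if i: "i \<in> {1..n}" for i
  proof (cases "k = n")
    case True
    then show ?thesis using i n nD by (cases "i = 1") (auto simp: rotated_def)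
  next
    case False
    then have "k mod n + 1 = k + 1" using k by simp
    moreover have "i - (k + 1) = i - 1 - k" "i < k + 1 \<Longrightarrow> i \<noteq> 1 \<Longrightarrow> n - (k + 1) + i = n - k + (i - 1)"
      using False k i by auto
    ultimately show ?thesis using False i k nD n by (cases "i = 1") (auto simp: rotated_def)
  qed
  moreover have "rotated n (k mod n + 1) D \<subseteq> {1..n}" by (auto simp: rotated_def)
  ultimately show ?thesis using mem[OF sub] by blast
qed

end

section \<open>Adding a disconnected cell\<close>

text \<open>The skew shape \<open>outer lam / [hd lam]\<close> is \<open>lam\<close> with a disconnected cell added at the upper right.\<close>

definition outer :: "nat list \<Rightarrow> nat list" where
  "outer lam = Suc (hd lam) # lam"

text \<open>The increasing relabelling that frees the value \<open>k\<close>. For \<open>k\<close>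
  at least 1 it fixes 0, the default value outside a shape.\<close>

definition bump :: "nat \<Rightarrow> nat \<Rightarrow> nat" where
  "bump k u = (if u < k then u else Suc u)"

definition unbump :: "nat \<Rightarrow> nat \<Rightarrow> nat" where
  "unbump k u = (if u < k then u else u - 1)"

definition insert_box :: "nat list \<Rightarrow> nat \<Rightarrow> (nat \<times> nat \<Rightarrow> nat) \<Rightarrow> nat \<times> nat \<Rightarrow> nat" where
  "insert_box lam k U x = (case fst x of 0 \<Rightarrow> if snd x = hd lam then k else 0
     | Suc r \<Rightarrow> bump k (U (r, snd x)))"

text \<open>The effect on descents of putting \<open>k\<close> into the added cell: above all other
  cells, it makes \<open>k\<close> a descent if \<open>k < n\<close> and never allows
  \<open>k - 1\<close>. Descents straddling neither move by the relabelling.\<close>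

definition inserted :: "nat \<Rightarrow> nat \<Rightarrow> nat set \<Rightarrow> nat set" where
  "inserted n k D = {i \<in> {1..n-1}. i = k \<or> (Suc i < k \<and> i \<in> D) \<or> (k < i \<and> i - 1 \<in> D)}"

lemma bump_eq_iff [simp]: "bump k u = bump k v \<longleftrightarrow> u = v"
  by (auto simp: bump_def)

lemma bump_less_iff [simp]: "bump k u < bump k v \<longleftrightarrow> u < v"
  by (auto simp: bump_def)

lemma bump_neq [simp]: "bump k u \<noteq> k" "k \<noteq> bump k u"
  by (auto simp: bump_def)

lemma unbump_bump [simp]: "unbump k (bump k u) = u"
  by (auto simp: bump_def unbump_def)

lemma bump_unbump: "u \<noteq> k \<Longrightarrow> bump k (unbump k u) = u"
  by (auto simp: bump_def unbump_def)

context
  fixes lam :: "nat list" and m n :: nat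
  assumes lam: "lam \<in> partitions_of m" and m: "m \<ge> 1" and n: "n = Suc m"
begin

private abbreviation "C \<equiv> cells lam []"
private abbreviation "C' \<equiv> cells (outer lam) [hd lam]"

lemma lam_facts: "is_partition lam" "card C = m" "lam \<noteq> []" "part lam 0 = hd lam" "0 < hd lam"
proof -
  show p: "is_partition lam" and "card C = m"
    using lam by (auto simp: partitions_of_def card_cells_straight)
  show ne: "lam \<noteq> []" using lam m by (auto simp: partitions_of_def)
  then show "part lam 0 = hd lam" by (simp add: part_def hd_conv_nth)
  show "0 < hd lam" using p ne by (auto simp: is_partition_def)
qed

lemma outer_cells [simp]:
  "(0, c) \<in> C' \<longleftrightarrow> c = hd lam"
  "(Suc r, c) \<in> C' \<longleftrightarrow> (r, c) \<in> C"
  by (auto simp: cells_def outer_def part_def)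

lemma outer_cells_eq: "C' = insert (0, hd lam) ((\<lambda>(r, c). (Suc r, c)) ` C)"
proof (rule set_eqI)
  fix x :: "nat \<times> nat"
  obtain r c where x: "x = (r, c)" by (cases x)
  show "x \<in> C' \<longleftrightarrow> x \<in> insert (0, hd lam) ((\<lambda>(r, c). (Suc r, c)) ` C)"
    unfolding x by (cases r) (force simp: image_iff)+
qed

lemma card_outer_cells: "card C' = n"
proof -
  have "inj_on (\<lambda>(r, c). (Suc r, c)) C" by (auto simp: inj_on_def)
  then show ?thesis
    unfolding outer_cells_eq using lam_facts(2) n
    by (subst card_insert_disjoint) (auto simp: finite_cells card_image)
qed

lemma skew_shape_outer: "skew_shape (outer lam) [hd lam]"
proof -
  have "\<forall>x\<in>set lam. x \<le> Suc (hd lam)"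
    using lam_facts(1,3) by (cases lam) (auto simp: is_partition_def le_SucI)
  then show ?thesis
    using lam_facts by (auto simp: skew_shape_def outer_def is_partition_def)
qed

text \<open>The cell of the top row has no neighbour.\<close>

lemma not_connected_ribbon_outer: "\<not> connected_ribbon (outer lam) [hd lam]"
proof
  assume "connected_ribbon (outer lam) [hd lam]"
  moreover have "(0, hd lam) \<in> C'" "(Suc 0, 0) \<in> C'"
    using lam_facts by (auto simp: cells_straight)
  ultimately have "((0, hd lam), (Suc 0, 0)) \<in> (cell_adj C')\<^sup>*"
    unfolding connected_ribbon_def Let_def by blast
  then obtain y where "((0, hd lam), y) \<in> cell_adj C'"
    by (metis converse_rtranclE fst_conv old.nat.distinct(1))
  then obtain r c where C: "(r, c) \<in> C'" and
    adj: "(r = 0 \<and> (c = hd lam + 1 \<or> hd lam = c + 1)) \<or> (c = hd lam \<and> r = 1)"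
    by (cases y) (auto simp: cell_adj_def)
  show False
  proof (cases r)
    case 0
    then have "c = hd lam" using C by simp
    then show False using adj 0 by simp
  next
    case (Suc s)
    then have "s = 0" "c = hd lam" using adj by auto
    then show False using C Suc lam_facts(4) by (simp add: cells_straight)
  qed
qed

lemma insert_box_simps [simp]:
  "insert_box lam k U (0, hd lam) = k"
  "insert_box lam k U (Suc r, c) = bump k (U (r, c))"
  by (auto simp: insert_box_def)

lemma bij_betw_insert_box:
  assumes U: "bij_betw U C {1..m}" and k: "k \<in> {1..n}"
  shows "bij_betw (insert_box lam k U) C' {1..n}"
proof -
  have inj: "inj_on U C" and im: "\<And>x. x \<in> C \<Longrightarrow> 1 \<le> U x \<and> U x \<le> m"
    using U by (auto simp: bij_betw_def)
  have "inj_on (insert_box lam k U) C'"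
  proof (rule inj_onI)
    fix x y assume xy: "x \<in> C'" "y \<in> C'" "insert_box lam k U x = insert_box lam k U y"
    obtain r c r' c' where eq: "x = (r, c)" "y = (r', c')" by (cases x; cases y)
    show "x = y"
      using xy inj unfolding eq by (cases r; cases r') (auto dest: inj_onD)
  qed
  moreover have "insert_box lam k U ` C' \<subseteq> {1..n}"
    unfolding outer_cells_eq using k im n by (force simp: bump_def)
  ultimately show ?thesis
    unfolding bij_betw_def using card_outer_cells
    by (simp add: card_image card_subset_eq)
qed

lemma insert_box_in:
  assumes U: "U \<in> syt lam []" and k: "k \<in> {1..n}"
  shows "insert_box lam k U \<in> syt (outer lam) [hd lam]"
proof -
  have "insert_box lam k U x = 0" if "x \<notin> C'" for x
  proof -
    obtain r c where x: "x = (r, c)" by (cases x)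
    show ?thesis using that U k unfolding x
      by (cases r) (auto simp: insert_box_def bump_def syt_def)
  qed
  moreover have "insert_box lam k U (r, c) < insert_box lam k U (r, c + 1)"
    if "(r, c) \<in> C'" "(r, c + 1) \<in> C'" for r c
    using that U by (cases r) (auto simp: syt_def)
  moreover have "insert_box lam k U (r, c) < insert_box lam k U (r + 1, c)"
    if "(r, c) \<in> C'" "(r + 1, c) \<in> C'" for r c
    using that U lam_facts(4) by (cases r) (auto simp: syt_def cells_straight)
  moreover have "bij_betw (insert_box lam k U) C' {1..n}"
    using U k lam_facts(2) by (intro bij_betw_insert_box) (auto simp: syt_def)
  ultimately show ?thesis by (simp add: syt_def card_outer_cells)
qed

definition remove_box :: "(nat \<times> nat \<Rightarrow> nat) \<Rightarrow> nat \<times> nat \<Rightarrow> nat" where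
  "remove_box T x = unbump (T (0, hd lam)) (T (Suc (fst x), snd x))"

text \<open>Cells off the shape are included, where \<open>T\<close> is 0 and the top entry is
  positive, so that \<open>bump_unbump\<close> applies to every argument and tableaux agree as
  functions.\<close>

lemma outer_syt_neq:
  assumes T: "T \<in> syt (outer lam) [hd lam]"
  shows "T (Suc r, c) \<noteq> T (0, hd lam)"
proof (cases "(r, c) \<in> C")
  case True
  then show ?thesis using T inj_onD[of T C' "(Suc r, c)" "(0, hd lam)"]
    by (auto simp: syt_def bij_betw_def)
next
  case False
  have "T (0, hd lam) \<in> {1..n}"
    using T bij_betwE[of T C' "{1..n}"] card_outer_cells by (auto simp: syt_def)
  moreover have "T (Suc r, c) = 0" using T False by (auto simp: syt_def)
  ultimately show ?thesis by auto
qed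

lemma insert_remove_box:
  assumes T: "T \<in> syt (outer lam) [hd lam]"
  shows "insert_box lam (T (0, hd lam)) (remove_box T) = T"
proof
  fix x :: "nat \<times> nat"
  obtain r c where x: "x = (r, c)" by (cases x)
  show "insert_box lam (T (0, hd lam)) (remove_box T) x = T x"
  proof (cases r)
    case 0
    then show ?thesis using T x by (auto simp: insert_box_def syt_def)
  next
    case (Suc s)
    then show ?thesis
      using x bump_unbump[OF outer_syt_neq[OF T]] by (simp add: remove_box_def)
  qed
qed

lemma remove_box_in:
  assumes T: "T \<in> syt (outer lam) [hd lam]"
  shows "remove_box T \<in> syt lam []" and "T (0, hd lam) \<in> {1..n}"
proof -
  let ?k = "T (0, hd lam)" and ?U = "remove_box T"
  have bij: "bij_betw T C' {1..n}" using T card_outer_cells by (simp add: syt_def)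
  show k: "?k \<in> {1..n}" using bij_betwE[OF bij] by auto
  have up: "T (Suc r, c) = bump ?k (?U (r, c))" for r c
    using fun_cong[OF insert_remove_box[OF T], of "(Suc r, c)"] by simp
  have "?U x = 0" if "x \<notin> C" for x
  proof -
    have "(Suc (fst x), snd x) \<notin> C'" using that by simp
    then have "T (Suc (fst x), snd x) = 0" using T unfolding syt_def by blast
    then show ?thesis using k by (simp add: remove_box_def unbump_def)
  qed
  moreover have "?U (r, c) < ?U (r, c + 1)" if "(r, c) \<in> C" "(r, c + 1) \<in> C" for r c
  proof -
    have "T (Suc r, c) < T (Suc r, c + 1)" using T that by (auto simp: syt_def)
    then show ?thesis by (simp only: up bump_less_iff)
  qed
  moreover have "?U (r, c) < ?U (r + 1, c)" if "(r, c) \<in> C" "(r + 1, c) \<in> C" for r c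
  proof -
    have "T (Suc r, c) < T (Suc (r + 1), c)" using T that by (auto simp: syt_def)
    then show ?thesis by (simp only: up bump_less_iff)
  qed
  moreover have "bij_betw ?U C {1..m}"
  proof -
    have "inj_on ?U C"
    proof (rule inj_onI, clarify)
      fix r c r' c' assume "(r, c) \<in> C" "(r', c') \<in> C" "?U (r, c) = ?U (r', c')"
      then have "T (Suc r, c) = T (Suc r', c')" by (simp add: up)
      then show "r = r' \<and> c = c'"
        using bij \<open>(r, c) \<in> C\<close> \<open>(r', c') \<in> C\<close> inj_onD[of T C' "(Suc r, c)" "(Suc r', c')"]
        by (auto simp: bij_betw_def)
    qed
    moreover have "?U ` C \<subseteq> {1..m}"
    proof clarify
      fix r c assume "(r, c) \<in> C"
      then have "T (Suc r, c) \<in> {1..n}" using bij_betwE[OF bij] by simp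
      then show "?U (r, c) \<in> {1..m}" using up[of r c] k n by (auto simp: bump_def split: if_splits)
    qed
    ultimately show ?thesis
      unfolding bij_betw_def using lam_facts(2) by (simp add: card_image card_subset_eq)
  qed
  ultimately show "?U \<in> syt lam []" by (simp add: syt_def lam_facts(2))
qed

lemma bij_betw_syt_outer:
  "bij_betw (\<lambda>(U, k). insert_box lam k U) (syt lam [] \<times> {1..n}) (syt (outer lam) [hd lam])"
proof (rule bij_betw_byWitness[where f' = "\<lambda>T. (remove_box T, T (0, hd lam))"])
  show "\<forall>a\<in>syt lam [] \<times> {1..n}.
      (remove_box (case a of (U, k) \<Rightarrow> insert_box lam k U),
        (case a of (U, k) \<Rightarrow> insert_box lam k U) (0, hd lam)) = a"
    by (auto simp: fun_eq_iff remove_box_def)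
  show "\<forall>T\<in>syt (outer lam) [hd lam].
      (case (remove_box T, T (0, hd lam)) of (U, k) \<Rightarrow> insert_box lam k U) = T"
    by (auto simp: insert_remove_box)
  show "(\<lambda>(U, k). insert_box lam k U) ` (syt lam [] \<times> {1..n}) \<subseteq> syt (outer lam) [hd lam]"
    using insert_box_in by auto
  show "(\<lambda>T. (remove_box T, T (0, hd lam))) ` syt (outer lam) [hd lam] \<subseteq> syt lam [] \<times> {1..n}"
    using remove_box_in by blast
qed

lemma syt_des_insert_box:
  assumes U: "U \<in> syt lam []" and k: "k \<in> {1..n}"
  shows "syt_des (outer lam) [hd lam] (insert_box lam k U) = inserted n k (syt_des lam [] U)"
proof -
  let ?T = "insert_box lam k U"
  have bU: "bij_betw U C {1..card C}" using U by (simp add: syt_def)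
  have bT: "bij_betw ?T C' {1..card C'}" using insert_box_in[OF U k] by (simp add: syt_def)
  have "i \<in> syt_des (outer lam) [hd lam] ?T \<longleftrightarrow> i \<in> inserted n k (syt_des lam [] U)"
    if i: "i \<in> {1..n-1}" for i
  proof -
    have "?T ` C' = {1..n}" using bT card_outer_cells by (simp add: bij_betw_def)
    then have im: "i \<in> ?T ` C'" "Suc i \<in> ?T ` C'" using i by auto
    obtain x where x: "?T x = i" "x \<in> C'" using im(1) by auto
    obtain y where y: "?T y = Suc i" "y \<in> C'" using im(2) by (metis imageE)
    have iff: "i \<in> syt_des (outer lam) [hd lam] ?T \<longleftrightarrow> fst x < fst y"
      using syt_des_iff[OF bT x(2) y(2)] x y by simp
    obtain r c r' c' where eq: "x = (r, c)" "y = (r', c')" by (cases x; cases y)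
    show ?thesis
    proof (cases r)
      case 0
      then have "i = k" using x eq by auto
      then have "r' \<noteq> 0" using y eq by (cases r') auto
      then show ?thesis using iff 0 eq i \<open>i = k\<close> by (auto simp: inserted_def)
    next
      case (Suc s)
      then have s: "(s, c) \<in> C" "bump k (U (s, c)) = i" using x eq by auto
      show ?thesis
      proof (cases r')
        case 0
        then have "Suc i = k" using y eq by auto
        then show ?thesis using iff 0 eq by (auto simp: inserted_def)
      next
        case (Suc s')
        then have s': "(s', c') \<in> C" "bump k (U (s', c')) = Suc i" using y eq by auto
        have ne: "i \<noteq> k" "Suc i \<noteq> k" using s s' by auto
        then have val: "U (s, c) = (if i < k then i else i - 1)" "U (s', c') = Suc (U (s, c))"
          using s s' i by (auto simp: bump_def split: if_splits)
        have "fst x < fst y \<longleftrightarrow> s < s'" using eq Suc \<open>r = Suc s\<close> by simp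
        also have "\<dots> \<longleftrightarrow> U (s, c) \<in> syt_des lam [] U"
          using syt_des_iff[OF bU s(1) s'(1) val(2)] by simp
        also have "\<dots> \<longleftrightarrow> i \<in> inserted n k (syt_des lam [] U)"
          using ne i val(1) by (auto simp: inserted_def)
        finally show ?thesis using iff by simp
      qed
    qed
  qed
  moreover have "syt_des (outer lam) [hd lam] ?T \<subseteq> {1..n-1}"
    using syt_des_subset[of "outer lam" "[hd lam]" ?T] card_outer_cells by simp
  moreover have "inserted n k (syt_des lam [] U) \<subseteq> {1..n-1}" by (auto simp: inserted_def)
  ultimately show ?thesis by blast
qed

end

section \<open>Existence of the cyclic descent extension\<close>

context
  fixes m n k :: nat and E :: "nat set"
  assumes n: "n = Suc m" and E: "E \<subseteq> {1..m}" and k: "k \<in> {1..n}" and kE: "k \<in> E \<or> k = n"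
begin

private lemma finE: "finite E"
  using E by (rule finite_subset) simp

private lemma strict [simp]: "block E i < block E (Suc i) \<longleftrightarrow> i \<in> E"
  by (simp add: block_Suc[OF finE])

text \<open>This is why raising by \<open>Suc n\<close> in \<open>rotated_word\<close> lifts a
  letter above all unraised ones.\<close>

private lemma block_bound: "block E i < Suc n"
proof -
  have "block E i \<le> card {1..m}" unfolding block_def using E by (intro card_mono) auto
  then show ?thesis using n by simp
qed

private lemma block_Suc_k: "k \<noteq> n \<Longrightarrow> block E (Suc k) = Suc (block E k)"
  using kE by (simp add: block_Suc[OF finE])

text \<open>Both words list the values of \<open>block E\<close> on \<open>{1..n} - {k}\<close>: the first in increasing order of position,
  the second cyclically from position \<open>k + 1\<close> on, where the values after the wrap are raised above all others.\<close>

definition deleted_word :: "nat \<Rightarrow> nat" where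
  "deleted_word i = (if i < k then block E i else block E (Suc i))"

definition rotated_word :: "nat \<Rightarrow> nat" where
  "rotated_word i = (if i \<le> n - k then block E (i + k) else block E (i - (n - k)) + Suc n)"

lemma deleted_word_mono: "i \<le> j \<Longrightarrow> deleted_word i \<le> deleted_word j"
  unfolding deleted_word_def by (auto intro: block_mono[OF finE])

lemma rotated_word_mono: "i \<le> j \<Longrightarrow> rotated_word i \<le> rotated_word j"
  using block_bound[of "i + k"] unfolding rotated_word_def
  by (auto intro!: block_mono[OF finE] diff_le_mono intro: trans_le_add2)

text \<open>Deleting position \<open>k\<close> shifts the tests beyond it by one. An element
  \<open>k - 1\<close> of \<open>D\<close> leaves no trace in \<open>inserted\<close>; accordingly
  the word always rises there, because it passes over the rise at \<open>k\<close>.\<close>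

lemma inserted_subset_iff:
  assumes D: "D \<subseteq> {1..m-1}"
  shows "inserted n k D \<subseteq> E \<longleftrightarrow> (\<forall>i\<in>D. deleted_word i < deleted_word (i+1))"
proof -
  have *: "deleted_word i < deleted_word (i+1) \<longleftrightarrow>
      (if Suc i < k then i \<in> E else if Suc i = k then True else Suc i \<in> E)" if "i \<in> D" for i
  proof (cases "Suc i = k")
    case True
    have "i \<in> {1..m-1}" using that D by blast
    then have "i \<noteq> m" "i \<le> m" by auto
    then have "k \<noteq> n" using True n by simp
    then have "block E (Suc k) = Suc (block E k)" by (rule block_Suc_k)
    moreover have "block E i \<le> block E k" using True by (intro block_mono[OF finE]) simp
    ultimately show ?thesis using True by (auto simp: deleted_word_def)
  qed (auto simp: deleted_word_def)
  show ?thesis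
  proof
    assume L: "inserted n k D \<subseteq> E"
    show "\<forall>i\<in>D. deleted_word i < deleted_word (i+1)"
    proof
      fix i assume i: "i \<in> D"
      then have b: "1 \<le> i" "i \<le> m - 1" using D by auto
      have "Suc i < k \<Longrightarrow> i \<in> inserted n k D" "k \<le> i \<Longrightarrow> Suc i \<in> inserted n k D"
        using i b n by (auto simp: inserted_def)
      then show "deleted_word i < deleted_word (i+1)" using *[OF i] L by auto
    qed
  next
    assume R: "\<forall>i\<in>D. deleted_word i < deleted_word (i+1)"
    show "inserted n k D \<subseteq> E"
    proof
      fix i assume "i \<in> inserted n k D"
      then consider "i = k" "i \<noteq> n" | "Suc i < k" "i \<in> D" | "k < i" "i - 1 \<in> D"
        using n by (auto simp: inserted_def)
      then show "i \<in> E"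
      proof cases
        case 1 then show ?thesis using kE by simp
      next
        case 2 then show ?thesis using * R by auto
      next
        case 3
        then have "deleted_word (i - 1) < deleted_word (i - 1 + 1)" using R by blast
        then show ?thesis using 3 *[of "i - 1"] by auto
      qed
    qed
  qed
qed

text \<open>An element \<open>n - k\<close> of \<open>D\<close> rotates to \<open>n\<close>, which
  the intersection discards. Accordingly the word always rises at \<open>n - k\<close>, where the
  raised letters begin.\<close>

lemma rotated_subset_iff:
  assumes D: "D \<subseteq> {1..m-1}"
  shows "rotated n k D \<inter> {1..m} \<subseteq> E \<longleftrightarrow> (\<forall>i\<in>D. rotated_word i < rotated_word (i+1))"
proof -
  have *: "rotated_word i < rotated_word (i+1) \<longleftrightarrow>
      (if i < n - k then i + k \<in> E else if i = n - k then True else i - (n - k) \<in> E)" for i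
    using block_bound[of n] k by (auto simp: rotated_word_def Suc_diff_le)
  show ?thesis
  proof
    assume L: "rotated n k D \<inter> {1..m} \<subseteq> E"
    show "\<forall>i\<in>D. rotated_word i < rotated_word (i+1)"
    proof
      fix i assume i: "i \<in> D"
      then have b: "1 \<le> i" "i \<le> m - 1" using D by auto
      have "i + k \<in> rotated n k D \<inter> {1..m}" if "i < n - k"
        using i b n that by (auto simp: rotated_def)
      moreover have "i - (n - k) \<in> rotated n k D \<inter> {1..m}" if "n - k < i"
      proof -
        have "n - k + (i - (n - k)) = i" "i - (n - k) < k" "1 \<le> i - (n - k)" "i - (n - k) \<le> m"
          using that b k n by auto
        then show ?thesis using i n by (auto simp: rotated_def)
      qed
      ultimately show "rotated_word i < rotated_word (i+1)"
        unfolding * using L by (auto simp: not_less)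
    qed
  next
    assume R: "\<forall>i\<in>D. rotated_word i < rotated_word (i+1)"
    show "rotated n k D \<inter> {1..m} \<subseteq> E"
    proof
      fix i assume "i \<in> rotated n k D \<inter> {1..m}"
      then have i: "1 \<le> i" "i \<le> m" and "i \<in> rotated n k D" by auto
      then consider "i = k" | "k < i" "i - k \<in> D" | "i < k" "n - k + i \<in> D"
        by (auto simp: rotated_def)
      then show "i \<in> E"
      proof cases
        case 1 then show ?thesis using kE i n by auto
      next
        case 2
        then have "i - k + k \<in> E" using R *[of "i - k"] i n by (auto split: if_splits)
        then show ?thesis using 2 by simp
      next
        case 3
        then have "n - k + i - (n - k) \<in> E" using R *[of "n - k + i"] i by (auto split: if_splits)
        then show ?thesis by simp
      qed
    qed
  qed
qed

text \<open>Swaps the letters up to \<open>block E k\<close> with their raised copies. Because of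
  the rise at \<open>k\<close>, the letters before \<open>k\<close> are recognized by being at most
  \<open>block E k\<close>, so raising them is a permutation of the alphabet.\<close>

private definition exchange :: "nat \<Rightarrow> nat" where
  "exchange v = (if v \<le> block E k then v + Suc n
     else if Suc n \<le> v \<and> v \<le> block E k + Suc n then v - Suc n else v)"

private lemma exchange_exchange: "exchange (exchange v) = v"
  using block_bound[of k] by (auto simp: exchange_def)

private lemma exchange_permutes: "exchange permutes {..block E k + Suc n}"
proof (rule bij_imp_permutes)
  show "bij_betw exchange {..block E k + Suc n} {..block E k + Suc n}"
    by (rule bij_betw_byWitness[where f' = exchange])
      (auto simp: exchange_exchange, auto simp: exchange_def)
qed (auto simp: exchange_def)

private lemma content_rotated: "content m rotated_word = content m deleted_word \<circ> exchange"
proof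
  fix v
  \<comment> \<open>Sends a place of the rotated word to the place of the same letter in the deleted
    word; the \<open>- 1\<close> accounts for the missing position \<open>k\<close>.\<close>
  let ?rho = "\<lambda>i. if i \<le> n - k then i + k - 1 else i - (n - k)"
  have rho: "bij_betw ?rho {1..m} {1..m}"
    by (rule bij_betw_byWitness[where f' = "\<lambda>j. if j < k then j + (n - k) else j + 1 - k"])
      (use k n in auto)
  have eq: "rotated_word i = exchange (deleted_word (?rho i))" if i: "i \<in> {1..m}" for i
  proof (cases "i \<le> n - k")
    case True
    then have "k \<noteq> n" using i by auto
    then have "Suc (block E k) = block E (Suc k)" by (simp add: block_Suc_k)
    also have "\<dots> \<le> block E (i + k)" using i by (intro block_mono[OF finE]) auto
    finally show ?thesis using True i block_bound[of "i + k"]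
      by (auto simp: rotated_word_def deleted_word_def exchange_def)
  next
    case False
    then have "block E (i - (n - k)) \<le> block E k" "i - (n - k) < k"
      using i n k by (auto intro!: block_mono[OF finE])
    then show ?thesis using False
      by (auto simp: rotated_word_def deleted_word_def exchange_def)
  qed
  have "{i \<in> {1..m}. rotated_word i = v} = {i \<in> {1..m}. deleted_word (?rho i) = exchange v}"
    using eq exchange_exchange by (metis (no_types, lifting))
  moreover have "bij_betw ?rho {i \<in> {1..m}. deleted_word (?rho i) = exchange v}
      {j \<in> {1..m}. deleted_word j = exchange v}"
    using bij_betw_Collect[OF rho, of "\<lambda>i. deleted_word i = exchange v"
      "\<lambda>i. deleted_word (?rho i) = exchange v"] by simp
  ultimately show "content m rotated_word v = (content m deleted_word \<circ> exchange) v"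
    unfolding content_def by (simp add: bij_betw_same_card)
qed

text \<open>Both counts are Kostka numbers; the second content rearranges the first, so the symmetry of
  Schur functions applies.\<close>

lemma card_rotated_eq_inserted:
  assumes lam: "lam \<in> partitions_of m"
  shows "card {S \<in> syt lam []. rotated n k (syt_des lam [] S) \<inter> {1..m} \<subseteq> E} =
    card {S \<in> syt lam []. inserted n k (syt_des lam [] S) \<subseteq> E}"
proof -
  have p: "is_partition lam" "m = card (cells lam [])"
    using lam by (auto simp: partitions_of_def card_cells_straight)
  have D: "syt_des lam [] S \<subseteq> {1..m-1}" for S using syt_des_subset p(2) by blast
  have "card {S \<in> syt lam []. rotated n k (syt_des lam [] S) \<inter> {1..m} \<subseteq> E} =
      card (ssyt lam [] (content m rotated_word))"
    unfolding rotated_subset_iff[OF D]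
    using card_ssyt_content[OF p, of rotated_word] rotated_word_mono by simp
  also have "\<dots> = card (ssyt lam [] (content m deleted_word))"
    unfolding content_rotated using card_ssyt_permutes[OF p(1) exchange_permutes] by simp
  also have "\<dots> = card {S \<in> syt lam []. inserted n k (syt_des lam [] S) \<subseteq> E}"
    unfolding inserted_subset_iff[OF D]
    using card_ssyt_content[OF p, of deleted_word] deleted_word_mono by simp
  finally show ?thesis .
qed

end

section \<open>From counts to a descent-preserving bijection\<close>

lemma card_eq_of_card_subsets:
  assumes "finite X" "finite Y" "finite U" "\<And>x. x \<in> X \<Longrightarrow> g x \<subseteq> U" "\<And>y. y \<in> Y \<Longrightarrow> h y \<subseteq> U"
    and eq: "\<And>E. E \<subseteq> U \<Longrightarrow> card {x \<in> X. g x \<subseteq> E} = card {y \<in> Y. h y \<subseteq> E}"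
  shows "card {x \<in> X. g x = D} = card {y \<in> Y. h y = D}"
proof (cases "D \<subseteq> U")
  case True
  have "real (card {x \<in> X. g x = D}) = real (card {y \<in> Y. h y = D})"
  proof (rule subset_sum_inject[OF assms(3) _ True])
    fix E assume E: "E \<subseteq> U"
    then have "finite (Pow E)" using assms(3) finite_subset by blast
    then show "(\<Sum>D\<in>Pow E. real (card {x \<in> X. g x = D})) =
        (\<Sum>D\<in>Pow E. real (card {y \<in> Y. h y = D}))"
      using eq[OF E] sum_card_fibres[OF assms(1), of "Pow E" g]
        sum_card_fibres[OF assms(2), of "Pow E" h] by (simp flip: of_nat_sum)
  qed
  then show ?thesis by simp
next
  case False
  then have "{x \<in> X. g x = D} = {}" "{y \<in> Y. h y = D} = {}" using assms(4,5) by blast+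
  then show ?thesis by (simp only: card.empty)
qed

lemma bij_betw_of_card_fibres:
  assumes fin: "finite X" "finite Y"
    and card: "\<And>D. card {x \<in> X. g x = D} = card {y \<in> Y. h y = D}"
  obtains b where "bij_betw b Y X" "\<And>y. y \<in> Y \<Longrightarrow> g (b y) = h y"
proof -
  have "\<exists>f. bij_betw f {y \<in> Y. h y = D} {x \<in> X. g x = D}" for D
    using fin card[of D] by (intro finite_same_card_bij) auto
  then obtain f where f: "\<And>D. bij_betw (f D) {y \<in> Y. h y = D} {x \<in> X. g x = D}" by metis
  define b where "b y = f (h y) y" for y
  have b: "b y \<in> X \<and> g (b y) = h y" if "y \<in> Y" for y
    using bij_betwE[OF f[of "h y"]] that by (auto simp: b_def)
  have "inj_on b Y"
  proof (rule inj_onI)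
    fix y z assume yz: "y \<in> Y" "z \<in> Y" "b y = b z"
    then have "h y = h z" using b by metis
    then show "y = z" using yz f[of "h y"] by (auto simp: b_def bij_betw_def dest: inj_onD)
  qed
  moreover have "X \<subseteq> b ` Y"
  proof
    fix x assume "x \<in> X"
    then have "x \<in> f (g x) ` {y \<in> Y. h y = g x}" using f[of "g x"] by (simp add: bij_betw_def)
    then obtain y where "x = f (g x) y" "y \<in> Y" "h y = g x" by auto
    then show "x \<in> b ` Y" by (intro image_eqI[of _ _ y]) (auto simp: b_def)
  qed
  ultimately show thesis using that[of b] b by (auto simp: bij_betw_def)
qed

lemma card_Times_slices:
  assumes "finite X" "finite K"
  shows "card {x \<in> X \<times> K. P x} = (\<Sum>k\<in>K. card {x \<in> X. P (x, k)})"
proof -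
  have "{x \<in> X \<times> K. P x} = (\<lambda>(k, x). (x, k)) ` (SIGMA k:K. {x \<in> X. P (x, k)})" by auto
  moreover have "inj_on (\<lambda>(k, x). (x, k)) (SIGMA k:K. {x \<in> X. P (x, k)})"
    by (auto simp: inj_on_def)
  ultimately show ?thesis using assms by (simp add: card_image)
qed

text \<open>Containment counts agree in every slice of constant \<open>k\<close>, so fibres of the
  two descent maps have equal sizes and a bijection \<open>b\<close> to pairs \<open>(S, k)\<close>
  exists. On pairs the required rotation only advances \<open>k\<close> cyclically, and the count
  for each \<open>J\<close> is inherited because \<open>cD\<close> is read off through
  \<open>b\<close>.\<close>

lemma cyclic_descent_ext_outer:
  assumes lam: "lam \<in> partitions_of m" and m: "m \<ge> 1" and n: "n = Suc m"
  shows "\<exists>cD. (\<exists>psi. cyclic_descent_ext (outer lam) [hd lam] cD psi) \<and>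
    (\<forall>J. card {T \<in> syt (outer lam) [hd lam]. cD T = J} =
       card {(S, k) \<in> syt lam [] \<times> {1..n}. rotated n k (syt_des lam [] S) = J})"
proof -
  let ?X = "syt lam [] \<times> {1..n}" and ?Y = "syt (outer lam) [hd lam]"
  let ?g = "\<lambda>(S, k). rotated n k (syt_des lam [] S)"
  have D: "syt_des lam [] S \<subseteq> {1..m-1}" for S
    using syt_des_subset[of lam "[]" S] lam by (auto simp: partitions_of_def card_cells_straight)
  have card': "card (cells (outer lam) [hd lam]) = n"
    using card_outer_cells[OF lam m n] .
  have finX: "finite ?X" by (simp add: finite_syt)
  have eq: "card {x \<in> ?X. ?g x \<inter> {1..m} = J} = card {T \<in> ?Y. syt_des (outer lam) [hd lam] T = J}" for J
  proof (rule card_eq_of_card_subsets[where U = "{1..m}"])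
    fix T
    show "syt_des (outer lam) [hd lam] T \<subseteq> {1..m}"
      using syt_des_subset[of "outer lam" "[hd lam]" T] card' n by simp
  next
    fix E :: "nat set" assume E: "E \<subseteq> {1..m}"
    let ?ins = "\<lambda>(U, k). insert_box lam k U" and ?h = "\<lambda>(U, k). inserted n k (syt_des lam [] U)"
    have "{T \<in> ?Y. syt_des (outer lam) [hd lam] T \<subseteq> E} =
        ?ins ` {x \<in> ?X. ?h x \<subseteq> E}"
    proof -
      have Y: "?Y = ?ins ` ?X" using bij_betw_syt_outer[OF lam m n] by (simp add: bij_betw_def)
      have "syt_des (outer lam) [hd lam] (?ins x) = ?h x" if "x \<in> ?X" for x
        using that syt_des_insert_box[OF lam m n] by auto
      then have "{x \<in> ?X. syt_des (outer lam) [hd lam] (?ins x) \<subseteq> E} =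
          {x \<in> ?X. ?h x \<subseteq> E}" by auto
      then show ?thesis unfolding Y by blast
    qed
    moreover have "inj_on ?ins {x \<in> ?X. ?h x \<subseteq> E}"
      by (rule inj_on_subset[OF bij_betw_imp_inj_on[OF bij_betw_syt_outer[OF lam m n]]]) auto
    ultimately have "card {T \<in> ?Y. syt_des (outer lam) [hd lam] T \<subseteq> E} =
        card {x \<in> ?X. ?h x \<subseteq> E}"
      by (simp only: card_image)
    moreover have "card {S \<in> syt lam []. rotated n k (syt_des lam [] S) \<inter> {1..m} \<subseteq> E} =
        card {U \<in> syt lam []. inserted n k (syt_des lam [] U) \<subseteq> E}" if k: "k \<in> {1..n}" for k
    proof (cases "k \<in> E \<or> k = n")
      case True
      then show ?thesis using card_rotated_eq_inserted[OF n E k _ lam] by blast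
    next
      case False
      \<comment> \<open>Both sets contain \<open>k\<close>, which is below \<open>n\<close> and not
        in \<open>E\<close>, so both counts are zero.\<close>
      then have "k \<in> rotated n k (syt_des lam [] S) \<inter> {1..m}" "k \<in> inserted n k (syt_des lam [] S)" for S
        using k n by (auto simp: rotated_def inserted_def)
      then have "\<not> rotated n k (syt_des lam [] S) \<inter> {1..m} \<subseteq> E"
        "\<not> inserted n k (syt_des lam [] S) \<subseteq> E" for S
        using False by blast+
      then show ?thesis by (simp only: simp_thms)
    qed
    ultimately show "card {x \<in> ?X. ?g x \<inter> {1..m} \<subseteq> E} =
        card {T \<in> ?Y. syt_des (outer lam) [hd lam] T \<subseteq> E}"
      by (simp only: card_Times_slices finite_syt finite_atLeastAtMost prod.case cong: sum.cong)
  qed (auto simp: finX finite_syt)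
  obtain b where b: "bij_betw b ?Y ?X"
    and des: "\<And>T. T \<in> ?Y \<Longrightarrow> ?g (b T) \<inter> {1..m} = syt_des (outer lam) [hd lam] T"
    using bij_betw_of_card_fibres[OF finX finite_syt eq] by metis
  define cD where "cD T = ?g (b T)" for T
  define nxt where "nxt = (\<lambda>(S :: nat \<times> nat \<Rightarrow> nat, k). (S, k mod n + 1))"
  define psi where "psi T = inv_into ?Y b (nxt (b T))" for T
  have nxt: "bij_betw nxt ?X ?X"
  proof -
    have "inj_on nxt ?X"
    proof (rule inj_onI, clarify)
      fix S k S' k' assume k: "k \<in> {1..n}" "k' \<in> {1..n}" and e: "nxt (S, k) = nxt (S', k')"
      have "k mod n = (if k = n then 0 else k)" "k' mod n = (if k' = n then 0 else k')"
        using k by auto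
      then show "S = S' \<and> k = k'" using e k by (auto simp: nxt_def split: if_splits)
    qed
    moreover have "nxt ` ?X \<subseteq> ?X" using n by (auto simp: nxt_def Suc_le_eq)
    ultimately show ?thesis using finX by (simp add: bij_betw_def endo_inj_surj)
  qed
  have bpsi: "b (psi T) = nxt (b T)" if "T \<in> ?Y" for T
  proof -
    have "b T \<in> ?X" using bij_betwE[OF b] that by blast
    then have "nxt (b T) \<in> ?X" by (rule bspec[OF bij_betwE[OF nxt]])
    then show ?thesis unfolding psi_def by (rule bij_betw_inv_into_right[OF b])
  qed
  have "psi = inv_into ?Y b \<circ> (nxt \<circ> b)" by (simp add: psi_def fun_eq_iff)
  then have "bij_betw psi ?Y ?Y"
    using bij_betw_trans[OF bij_betw_trans[OF b nxt] bij_betw_inv_into[OF b]] by (simp only:)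
  moreover have "cD T \<subseteq> {1..n} \<and> cD T \<inter> {1..n-1} = syt_des (outer lam) [hd lam] T \<and>
      cD (psi T) = shift1 n (cD T) \<and> cD T \<noteq> {} \<and> cD T \<noteq> {1..n}" if T: "T \<in> ?Y" for T
  proof -
    obtain S k where Sk: "b T = (S, k)" by (cases "b T")
    then have k: "k \<in> {1..n}" using bij_betwE[OF b] T by fastforce
    have cD: "cD T = rotated n k (syt_des lam [] S)" by (simp add: cD_def Sk)
    have "cD (psi T) = rotated n (k mod n + 1) (syt_des lam [] S)"
      by (simp add: cD_def bpsi[OF T] Sk nxt_def)
    also have "\<dots> = shift1 n (cD T)"
      unfolding cD
    proof (rule rotated_shift)
      show "syt_des lam [] S \<subseteq> {1..n-1}" using D[of S] by (rule subset_trans) (use n in auto)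
    qed (use k n m in auto)
    finally have "cD (psi T) = shift1 n (cD T)" .
    moreover have "k \<in> cD T" using k by (auto simp: cD rotated_def)
    \<comment> \<open>The cyclic predecessor of \<open>k\<close> is \<open>k + m\<close> modulo
      \<open>n\<close>, and \<open>m\<close> is too large to be a descent of \<open>S\<close>. This
      keeps \<open>cD T\<close> from being everything, as \<open>k\<close> keeps it from being
      empty.\<close>
    moreover have "(if k = 1 then n else k - 1) \<notin> cD T"
    proof -
      have "m \<notin> {1..m-1}" using m by auto
      then have "m \<notin> syt_des lam [] S" using D[of S] by blast
      then show ?thesis using k n m by (auto simp: cD rotated_def)
    qed
    moreover have "(if k = 1 then n else k - 1) \<in> {1..n}" using k by auto
    moreover have "cD T \<subseteq> {1..n}" by (auto simp: cD rotated_def)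
    moreover have "cD T \<inter> {1..n-1} = syt_des (outer lam) [hd lam] T"
      using des[OF T] n by (simp add: cD_def)
    ultimately show ?thesis by blast
  qed
  ultimately have "cyclic_descent_ext (outer lam) [hd lam] cD psi"
    unfolding cyclic_descent_ext_def Let_def card' by blast
  moreover have "card {T \<in> ?Y. cD T = J} = card {(S, k) \<in> ?X. rotated n k (syt_des lam [] S) = J}" for J
  proof -
    have "bij_betw b {T \<in> ?Y. cD T = J} {x \<in> ?X. ?g x = J}"
      by (rule bij_betw_Collect[OF b]) (simp add: cD_def)
    then have "card {T \<in> ?Y. cD T = J} = card {x \<in> ?X. ?g x = J}" by (rule bij_betw_same_card)
    also have "{x \<in> ?X. ?g x = J} = {(S, k) \<in> ?X. rotated n k (syt_des lam [] S) = J}" by auto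
    finally show ?thesis .
  qed
  ultimately show ?thesis by blast
qed

section \<open>Cyclic Schur-positivity\<close>

text \<open>The count depends on \<open>g\<close> only through its fibre sizes, and linearly. Hence
  the linear relation of \<open>des_count\<close> carries over from descent sets to rotated
  sets.\<close>

lemma card_rotated_pairs:
  assumes "finite X" "\<And>x. x \<in> X \<Longrightarrow> g x \<in> P" "finite P"
  shows "card {(x, k) \<in> X \<times> {1..n}. rotated n k (g x) = J} =
    (\<Sum>k=1..n. \<Sum>D\<in>{D \<in> P. rotated n k D = J}. card {x \<in> X. g x = D})"
proof -
  have "{(x, k) \<in> X \<times> {1..n}. rotated n k (g x) = J} =
      {y \<in> X \<times> {1..n}. rotated n (snd y) (g (fst y)) = J}" by auto
  moreover have "card {x \<in> X. rotated n k (g x) = J} =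
      (\<Sum>D\<in>{D \<in> P. rotated n k D = J}. card {x \<in> X. g x = D})" for k
  proof -
    have "{x \<in> X. rotated n k (g x) = J} = {x \<in> X. g x \<in> {D \<in> P. rotated n k D = J}}"
      using assms(2) by auto
    then show ?thesis using sum_card_fibres[of X "{D \<in> P. rotated n k D = J}" g] assms(1,3) by simp
  qed
  ultimately show ?thesis using card_Times_slices[of X "{1..n}"] assms(1) by simp
qed

theorem theorem3p11:
  fixes n :: nat and A :: "(nat \<Rightarrow> nat) set"
  assumes "n \<ge> 2"
    and "A \<subseteq> {s. s permutes {1..n-1}}"
    and "schur_positive (n-1) A"
  shows "cyclic_schur_positive n {s \<circ> c | s c. s \<in> A \<and> c \<in> cyclic_group n}"
proof -
  define m where "m = n - 1"
  have m: "m \<ge> 1" "n = Suc m" using assms(1) by (auto simp: m_def)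
  let ?P = "partitions_of m"
  have finA: "finite A" using assms(2) by (rule finite_subset) (simp add: finite_permutations)
  obtain c :: "nat list \<Rightarrow> real" where c0: "\<And>lam. 0 \<le> c lam" and
    Q: "(\<lambda>alpha. \<Sum>p\<in>A. fundamental m (des m p) alpha) = (\<lambda>alpha. \<Sum>lam\<in>?P. c lam * schur lam alpha)"
    using assms(3) unfolding schur_positive_def Let_def m_def[symmetric] by blast
  have Q': "(\<Sum>p\<in>A. fundamental m (des m p) alpha) = (\<Sum>lam\<in>?P. c lam * schur lam alpha)" for alpha
    using fun_cong[OF Q] .
  define mult where "mult lam = nat \<lfloor>c lam\<rfloor>" for lam
  have mult: "real (mult lam) = c lam" if "lam \<in> ?P" for lam
  proof -
    \<comment> \<open>The left side of \<open>Q'\<close> is a sum of cardinalities, hence an integer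
      at every partition content, as \<open>schur_coefficients_Ints\<close> demands.\<close>
    have "c lam \<in> \<int>"
      using that by (rule schur_coefficients_Ints[rotated])
        (simp add: Q'[symmetric] fundamental_def Ints_sum)
    then show ?thesis using c0[of lam] by (auto simp: mult_def elim: Ints_cases)
  qed
  have "\<forall>lam\<in>?P. \<exists>cD. (\<exists>psi. cyclic_descent_ext (outer lam) [hd lam] cD psi) \<and>
      (\<forall>J. card {T \<in> syt (outer lam) [hd lam]. cD T = J} =
         card {(S, k) \<in> syt lam [] \<times> {1..n}. rotated n k (syt_des lam [] S) = J})"
    using cyclic_descent_ext_outer m by blast
  then obtain cD0 where
    ext: "\<And>lam. lam \<in> ?P \<Longrightarrow> \<exists>psi. cyclic_descent_ext (outer lam) [hd lam] (cD0 lam) psi" and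
    cnt: "\<And>lam J. lam \<in> ?P \<Longrightarrow> card {T \<in> syt (outer lam) [hd lam]. cD0 lam T = J} =
         card {(S, k) \<in> syt lam [] \<times> {1..n}. rotated n k (syt_des lam [] S) = J}"
    unfolding bchoice_iff by blast
  define sh where "sh lam = (outer lam, [hd lam])" for lam
  \<comment> \<open>\<open>lam\<close> is recovered from its shape, so different partitions use
    different shapes and their multiplicities need not be merged.\<close>
  have tl_sh [simp]: "tl (fst (sh lam)) = lam" for lam by (simp add: sh_def outer_def)
  have inj: "inj_on sh ?P" by (metis inj_onI tl_sh)
  define M where "M s = (if s \<in> sh ` ?P then mult (tl (fst s)) else 0)" for s
  define cD where "cD s = cD0 (tl (fst s))" for s :: "nat list \<times> nat list"
  have supp: "{s. M s \<noteq> 0} \<subseteq> sh ` ?P" by (auto simp: M_def)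
  have fin: "finite (sh ` ?P)" by (simp add: finite_partitions_of)
  have "card {p \<in> {s \<circ> c | s c. s \<in> A \<and> c \<in> cyclic_group n}. cdes n p = J} =
      (\<Sum>s\<in>{s. M s \<noteq> 0}. M s * card {T \<in> syt (fst s) (snd s). cD s T = J})" for J
  proof -
    let ?D = "\<lambda>k. {D \<in> Pow {1..m-1}. rotated n k D = J}"
    let ?f = "\<lambda>lam D. card {S \<in> syt lam []. syt_des lam [] S = D}"
    have "card {p \<in> {s \<circ> c | s c. s \<in> A \<and> c \<in> cyclic_group n}. cdes n p = J} =
        card {(s, k) \<in> A \<times> {1..n}. rotated n k (des m s) = J}"
      unfolding m_def by (rule card_cdes_cyc[OF assms(1,2)])
    also have "\<dots> = (\<Sum>k=1..n. \<Sum>D\<in>?D k. card {s \<in> A. des m s = D})"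
      using finA by (intro card_rotated_pairs) (auto simp: des_def)
    \<comment> \<open>The computation moves to the reals, where the coefficients \<open>c\<close>
      live, and returns once \<open>mult\<close> replaces them.\<close>
    also have "real \<dots> = (\<Sum>k=1..n. \<Sum>D\<in>?D k. \<Sum>lam\<in>?P. c lam * real (?f lam D))"
      by (simp add: des_count[OF finA Q'])
    also have "\<dots> = (\<Sum>k=1..n. \<Sum>lam\<in>?P. \<Sum>D\<in>?D k. c lam * real (?f lam D))"
      by (intro sum.cong refl sum.swap)
    also have "\<dots> = (\<Sum>lam\<in>?P. \<Sum>k=1..n. \<Sum>D\<in>?D k. c lam * real (?f lam D))"
      by (rule sum.swap)
    also have "\<dots> = (\<Sum>lam\<in>?P. real (mult lam *
        card {(S, k) \<in> syt lam [] \<times> {1..n}. rotated n k (syt_des lam [] S) = J}))"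
    proof (rule sum.cong)
      fix lam assume lam: "lam \<in> ?P"
      have "syt_des lam [] S \<in> Pow {1..m-1}" for S
        using syt_des_subset[of lam "[]" S] lam by (auto simp: partitions_of_def card_cells_straight)
      then have "card {(S, k) \<in> syt lam [] \<times> {1..n}. rotated n k (syt_des lam [] S) = J} =
          (\<Sum>k=1..n. \<Sum>D\<in>?D k. ?f lam D)"
        by (intro card_rotated_pairs) (auto simp: finite_syt)
      then show "(\<Sum>k=1..n. \<Sum>D\<in>?D k. c lam * real (?f lam D)) = real (mult lam *
          card {(S, k) \<in> syt lam [] \<times> {1..n}. rotated n k (syt_des lam [] S) = J})"
        by (simp add: mult[OF lam] sum_distrib_left)
    qed simp
    also have "\<dots> = real (\<Sum>lam\<in>?P. mult lam * card {T \<in> syt (outer lam) [hd lam]. cD0 lam T = J})"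
      by (simp add: cnt)
    also have "(\<Sum>lam\<in>?P. mult lam * card {T \<in> syt (outer lam) [hd lam]. cD0 lam T = J}) =
        (\<Sum>s\<in>sh ` ?P. M s * card {T \<in> syt (fst s) (snd s). cD s T = J})"
      unfolding sum.reindex[OF inj] by (rule sum.cong) (auto simp: M_def cD_def, simp add: sh_def)
    also have "\<dots> = (\<Sum>s\<in>{s. M s \<noteq> 0}. M s * card {T \<in> syt (fst s) (snd s). cD s T = J})"
      by (rule sum.mono_neutral_right[OF fin supp]) auto
    finally show ?thesis using of_nat_eq_iff by blast
  qed
  moreover have "skew_shape (fst s) (snd s) \<and> card (cells (fst s) (snd s)) = n \<and>
      \<not> connected_ribbon (fst s) (snd s) \<and> (\<exists>psi. cyclic_descent_ext (fst s) (snd s) (cD s) psi)"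
    if "M s \<noteq> 0" for s
  proof -
    obtain lam where lam: "lam \<in> ?P" and s: "s = sh lam" using supp \<open>M s \<noteq> 0\<close> by blast
    have "cD s = cD0 lam" by (simp add: cD_def s)
    then show ?thesis
      using skew_shape_outer[OF lam m] card_outer_cells[OF lam m]
        not_connected_ribbon_outer[OF lam m] ext[OF lam] by (simp add: s sh_def)
  qed
  moreover have "finite {s. M s \<noteq> 0}" using supp fin by (rule finite_subset)
  ultimately show ?thesis unfolding cyclic_schur_positive_def by blast
qed

end
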